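(* Let $\mathcal{P}$ be an induced-hereditary property. Then $\mathcal{P}$ has a unique factorisation (into arbitrary, not necessarily induced-hereditary, properties) if and only if one of the following holds: (1) $\mathcal{P}$ is irreducible; (2) $\mathcal{P} = \mathcal{O}(r)\circ\mathcal{O}(s)$ for some $r,s\le\infty$; (3) $\mathcal{P} = \mathcal{K}(r)\circ\mathcal{K}(s)$ for some $r,s\le\infty$; (4) $\mathcal{P} = \mathcal{O}(r)\circ\mathcal{K}(s)$ for some finite $r,s$.
   Context: All graphs are finite, simple and unlabelled. A property is a set of graphs; it is induced-hereditary if it is closed under taking induced subgraphs. For properties $\mathcal{P}_1,\mathcal{P}_2$, the product $\mathcal{P}_1\circ\mathcal{P}_2$ is the set of graphs $G$ whose vertex set can be partitioned into (possibly empty) sets $A,B$ with $G[A]\in\mathcal{P}_1$ and $G[B]\in\mathcal{P}_2$; products of more factors are defined analogously. A property is reducible if it is the product of two other properties, and irreducible otherwise. $\mathcal{P}$ has a unique factorisation if there is exactly one way, up to the order of the factors, to write $\mathcal{P}$ as a product of irreducible properties (for an irreducible property this is $\mathcal{P}$ itself). For a positive integer $s$, $\mathcal{O}(s)=\{\overline{K}_t \mid 1\le t\le s\}$ (edgeless graphs on at most $s$ vertices) and $\mathcal{K}(s)=\{K_t\mid 1\le t\le s\}$; $\mathcal{O}(\infty)$ is the set of all finite edgeless graphs and $\mathcal{K}(\infty)$ the set of all finite complete graphs. *)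

theory Defs
  imports "HOL-Library.Extended_Nat" "HOL-Library.Multiset" "HOL-Library.Disjoint_Sets"
begin

text \<open>
  Unlabelled finite graphs are represented by labelled graphs \<open>(V, E)\<close> with \<open>V\<close> a finite set of
  naturals; a property is an isomorphism-closed set of such graphs, so that equality of properties
  is equality of sets. The null graph is not a graph here: \<open>\<O>(s)\<close> and \<open>\<K>(s)\<close> start at one vertex, and
  an empty part of a vertex partition satisfies every property.
\<close>

type_synonym graph = "nat set \<times> nat set set"

abbreviation verts :: "graph \<Rightarrow> nat set" where "verts \<equiv> fst"
abbreviation edges :: "graph \<Rightarrow> nat set set" where "edges \<equiv> snd"

definition graphs :: "graph set" where
  "graphs = {G. finite (verts G) \<and> verts G \<noteq> {} \<and> (\<forall>e\<in>edges G. e \<subseteq> verts G \<and> card e = 2)}"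

definition induced :: "graph \<Rightarrow> nat set \<Rightarrow> graph" where
  "induced G A = (A, {e \<in> edges G. e \<subseteq> A})"

definition graph_iso :: "graph \<Rightarrow> graph \<Rightarrow> bool" where
  "graph_iso G H \<longleftrightarrow> (\<exists>f. bij_betw f (verts G) (verts H) \<and> edges H = (\<lambda>e. f ` e) ` edges G)"

definition graph_property :: "graph set \<Rightarrow> bool" where
  "graph_property P \<longleftrightarrow> P \<subseteq> graphs \<and> (\<forall>G\<in>P. \<forall>H\<in>graphs. graph_iso G H \<longrightarrow> H \<in> P)"

definition induced_hereditary :: "graph set \<Rightarrow> bool" where
  "induced_hereditary P \<longleftrightarrow> (\<forall>G\<in>P. \<forall>A. A \<subseteq> verts G \<and> A \<noteq> {} \<longrightarrow> induced G A \<in> P)"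

definition gprod :: "graph set \<Rightarrow> graph set \<Rightarrow> graph set" (infixl "\<odot>" 70) where
  "P \<odot> Q = {G \<in> graphs. \<exists>A B. A \<union> B = verts G \<and> A \<inter> B = {} \<and>
     (A = {} \<or> induced G A \<in> P) \<and> (B = {} \<or> induced G B \<in> Q)}"

definition gprods :: "graph set list \<Rightarrow> graph set" where
  "gprods Ps = {G \<in> graphs. \<exists>A :: nat \<Rightarrow> nat set.
     (\<Union>i<length Ps. A i) = verts G \<and> disjoint_family_on A {..<length Ps} \<and>
     (\<forall>i<length Ps. A i = {} \<or> induced G (A i) \<in> Ps ! i)}"

definition reducible_property :: "graph set \<Rightarrow> bool" where
  "reducible_property P \<longleftrightarrow>
     (\<exists>Q R. graph_property Q \<and> graph_property R \<and> Q \<noteq> P \<and> R \<noteq> P \<and> P = Q \<odot> R)"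

definition irreducible_property :: "graph set \<Rightarrow> bool" where
  "irreducible_property P \<longleftrightarrow> graph_property P \<and> \<not> reducible_property P"

text \<open>
  The empty property is the identity of the product and is itself irreducible, so it must not occur
  as a padding factor: otherwise no property would factor uniquely. It is allowed only as the sole
  factor, i.e. as the factorisation of the empty property itself.
\<close>

definition factorisation :: "graph set list \<Rightarrow> graph set \<Rightarrow> bool" where
  "factorisation Ps P \<longleftrightarrow> Ps \<noteq> [] \<and> (\<forall>Q\<in>set Ps. irreducible_property Q) \<and>
     (length Ps > 1 \<longrightarrow> {} \<notin> set Ps) \<and> P = gprods Ps"

definition unique_factorisation :: "graph set \<Rightarrow> bool" where
  "unique_factorisation P \<longleftrightarrow>
     (\<exists>Ps. factorisation Ps P \<and> (\<forall>Qs. factorisation Qs P \<longrightarrow> mset Qs = mset Ps))"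

definition edgeless_upto :: "enat \<Rightarrow> graph set" where
  "edgeless_upto s = {G \<in> graphs. edges G = {} \<and> enat (card (verts G)) \<le> s}"

definition complete_upto :: "enat \<Rightarrow> graph set" where
  "complete_upto s = {G \<in> graphs. edges G = {e. e \<subseteq> verts G \<and> card e = 2} \<and>
     enat (card (verts G)) \<le> s}"

lemma gprods_pair: "gprods [P, Q] = P \<odot> Q"
proof (intro set_eqI iffI)
  fix G assume "G \<in> gprods [P, Q]"
  then obtain A where G: "G \<in> graphs" and A: "(\<Union>i<2. A i) = verts G"
    "disjoint_family_on A {..<2::nat}" "\<forall>i<2. A i = {} \<or> induced G (A i) \<in> [P, Q] ! i"
    by (auto simp: gprods_def numeral_2_eq_2)
  have "A 0 \<union> A 1 = verts G" using A(1) by (auto simp: numeral_2_eq_2 lessThan_Suc)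
  moreover have "A 0 \<inter> A 1 = {}" using A(2) by (auto simp: disjoint_family_on_def)
  moreover have "A 0 = {} \<or> induced G (A 0) \<in> P" "A 1 = {} \<or> induced G (A 1) \<in> Q"
    using A(3)[rule_format, of 0] A(3)[rule_format, of 1] by auto
  ultimately show "G \<in> P \<odot> Q" using G unfolding gprod_def by blast
next
  fix G assume "G \<in> P \<odot> Q"
  then obtain A B where G: "G \<in> graphs" and AB: "A \<union> B = verts G" "A \<inter> B = {}"
    "A = {} \<or> induced G A \<in> P" "B = {} \<or> induced G B \<in> Q"
    unfolding gprod_def by blast
  show "G \<in> gprods [P, Q]"
    unfolding gprods_def using G AB
    by (auto intro!: exI[of _ "\<lambda>i::nat. if i = 0 then A else B"]
             simp: disjoint_family_on_def lessThan_Suc less_Suc_eq)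
qed

end

theory Submission
  imports Defs
begin

text \<open>
  Let \<open>P = Q \<odot> R\<close> with nonempty factors. If \<open>P = P \<odot> R\<close> then \<open>P\<close> is the class of all graphs, since
  \<open>n\<close> nonempty factors produce every graph on \<open>n\<close> vertices as an induced subgraph. For the same
  reason factors of any other \<open>P\<close> split into finitely many irreducible ones, so unique factorisation
  allows one to cancel: \<open>Q \<odot> R = Q' \<odot> R\<close> implies \<open>Q = Q'\<close>. Cancelling against the hereditary closure
  of \<open>Q\<close> shows that \<open>Q\<close> is hereditary. Cancelling against \<open>Q\<close> without the one-vertex graph shows that
  \<open>Q\<close> does not contain both graphs on two vertices (otherwise the removed vertex can be replaced by a
  pair), so \<open>Q\<close> is \<open>\<O>(r)\<close> or \<open>\<K>(r)\<close>, and that \<open>\<O>(r) \<odot> \<K>(\<infinity>)\<close> with \<open>r \<ge> 2\<close> is not unique.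
  As a product of two factors contains both graphs on two vertices, there are exactly two irreducible
  factors.

  Conversely, in \<open>\<O>(r) \<odot> \<O>(s)\<close> all factors are edgeless since triangles are excluded, and the
  complete bipartite graphs determine the admissible orders. In \<open>\<O>(r) \<odot> \<K>(s)\<close> the exclusion of
  \<open>2K\<^sub>2\<close> and \<open>C\<^sub>4\<close> forces homogeneous factors, whose orders are read off from complete split graphs.

  Edges and non-edges are treated symmetrically as the two colours of pairs of vertices.
\<close>

section \<open>Graphs, embeddings and products\<close>

text \<open>On a diagonal pair this asks for \<open>{u}\<close> among the edges, hence the guards
  \<open>u \<noteq> v\<close> throughout. For distinct vertices the two truth values are the two
  colours of a pair.\<close>

definition adj :: "graph \<Rightarrow> nat \<Rightarrow> nat \<Rightarrow> bool" where
  "adj G u v \<longleftrightarrow> {u, v} \<in> edges G"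

lemma adj_commute: "adj G u v = adj G v u"
  by (simp add: adj_def insert_commute)

lemma adj_induced: "u \<in> A \<Longrightarrow> v \<in> A \<Longrightarrow> adj (induced G A) u v = adj G u v"
  by (simp add: adj_def induced_def)

lemma verts_induced [simp]: "verts (induced G A) = A"
  by (simp add: induced_def)

lemma induced_induced: "B \<subseteq> A \<Longrightarrow> induced (induced G A) B = induced G B"
  by (auto simp: induced_def)

lemma induced_verts: "G \<in> graphs \<Longrightarrow> induced G (verts G) = G"
  by (auto simp: induced_def graphs_def prod_eq_iff)

lemma induced_in_graphs: "G \<in> graphs \<Longrightarrow> A \<subseteq> verts G \<Longrightarrow> A \<noteq> {} \<Longrightarrow> induced G A \<in> graphs"
  by (auto simp: induced_def graphs_def intro: finite_subset)

lemma finite_verts: "G \<in> graphs \<Longrightarrow> finite (verts G)"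
  by (simp add: graphs_def)

lemma verts_nonempty: "G \<in> graphs \<Longrightarrow> verts G \<noteq> {}"
  by (simp add: graphs_def)

lemma card_verts_pos: "G \<in> graphs \<Longrightarrow> 1 \<le> card (verts G)"
  by (simp add: finite_verts verts_nonempty Suc_le_eq card_gt_0_iff)

lemma edges_conv_adj:
  assumes "G \<in> graphs"
  shows "edges G = {{u, v} |u v. u \<in> verts G \<and> v \<in> verts G \<and> u \<noteq> v \<and> adj G u v}"
proof (intro set_eqI iffI)
  fix e assume e: "e \<in> edges G"
  then have "card e = 2" "e \<subseteq> verts G" using assms by (auto simp: graphs_def)
  then obtain u v where "e = {u, v}" "u \<noteq> v" by (auto simp: card_2_iff)
  with e \<open>e \<subseteq> verts G\<close> show "e \<in> {{u, v} |u v. u \<in> verts G \<and> v \<in> verts G \<and> u \<noteq> v \<and> adj G u v}"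
    by (auto simp: adj_def)
qed (auto simp: adj_def)

lemma graph_isoI:
  assumes "G \<in> graphs" "H \<in> graphs" "bij_betw f (verts G) (verts H)"
    and "\<And>u v. u \<in> verts G \<Longrightarrow> v \<in> verts G \<Longrightarrow> u \<noteq> v \<Longrightarrow> adj H (f u) (f v) = adj G u v"
  shows "graph_iso G H"
proof -
  have inj: "inj_on f (verts G)" and im: "f ` verts G = verts H"
    using assms(3) by (auto simp: bij_betw_def)
  have "edges H = (\<lambda>e. f ` e) ` edges G"
  proof (intro set_eqI iffI)
    fix e assume "e \<in> edges H"
    then obtain x y where e: "e = {x, y}" "x \<in> verts H" "y \<in> verts H" "x \<noteq> y" "adj H x y"
      using edges_conv_adj[OF assms(2)] by auto
    then obtain u v where uv: "u \<in> verts G" "v \<in> verts G" "x = f u" "y = f v" "u \<noteq> v"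
      using im by (metis imageE)
    then have "adj G u v" using assms(4) e by auto
    then show "e \<in> (\<lambda>e. f ` e) ` edges G"
      using e uv by (auto simp: adj_def intro!: image_eqI[of _ _ "{u, v}"])
  next
    fix e assume "e \<in> (\<lambda>e. f ` e) ` edges G"
    then obtain u v where "e = f ` {u, v}" "u \<in> verts G" "v \<in> verts G" "u \<noteq> v" "adj G u v"
      using edges_conv_adj[OF assms(1)] by auto
    with assms(4) show "e \<in> edges H" by (auto simp: adj_def)
  qed
  with assms(3) show ?thesis by (auto simp: graph_iso_def)
qed

definition mkgraph :: "nat set \<Rightarrow> (nat \<Rightarrow> nat \<Rightarrow> bool) \<Rightarrow> graph" where
  "mkgraph V C = (V, {{u, v} |u v. u \<in> V \<and> v \<in> V \<and> u \<noteq> v \<and> C u v})"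

lemma verts_mkgraph [simp]: "verts (mkgraph V C) = V"
  by (simp add: mkgraph_def)

lemma mkgraph_in_graphs: "finite V \<Longrightarrow> V \<noteq> {} \<Longrightarrow> mkgraph V C \<in> graphs"
  by (auto simp: mkgraph_def graphs_def)

lemma adj_mkgraph:
  assumes "u \<in> V" "v \<in> V" "u \<noteq> v" "C u v = C v u"
  shows "adj (mkgraph V C) u v = C u v"
  using assms by (auto simp: adj_def mkgraph_def doubleton_eq_iff)

lemma property_in_graphs: "graph_property P \<Longrightarrow> G \<in> P \<Longrightarrow> G \<in> graphs"
  by (auto simp: graph_property_def)

lemma property_iso: "graph_property P \<Longrightarrow> G \<in> P \<Longrightarrow> H \<in> graphs \<Longrightarrow> graph_iso G H \<Longrightarrow> H \<in> P"
  by (auto simp: graph_property_def)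

section \<open>Induced embeddings and the hereditary closure\<close>

definition embeds :: "(nat \<Rightarrow> nat) \<Rightarrow> graph \<Rightarrow> graph \<Rightarrow> bool" where
  "embeds f G H \<longleftrightarrow> inj_on f (verts G) \<and> f ` verts G \<subseteq> verts H \<and>
     (\<forall>u\<in>verts G. \<forall>v\<in>verts G. u \<noteq> v \<longrightarrow> adj H (f u) (f v) = adj G u v)"

lemma embeds_id: "embeds id G G"
  by (auto simp: embeds_def)

lemma embeds_induced: "A \<subseteq> verts G \<Longrightarrow> embeds id (induced G A) G"
  by (auto simp: embeds_def adj_induced)

lemma embeds_comp:
  assumes "embeds f G H" "embeds g H K"
  shows "embeds (g \<circ> f) G K"
proof -
  have "inj_on g (f ` verts G)"
    using assms by (meson embeds_def inj_on_subset)
  moreover have "f u \<noteq> f v" if "u \<in> verts G" "v \<in> verts G" "u \<noteq> v" for u v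
    using assms(1) that by (auto simp: embeds_def inj_on_def)
  ultimately show ?thesis
    using assms unfolding embeds_def by (auto simp: comp_inj_on image_subset_iff)
qed

text \<open>The inverse bijection is used, because closing \<open>hclose\<close> under isomorphism
  needs the new copy to embed into the old graph.\<close>

lemma graph_iso_embeds:
  assumes "G \<in> graphs" "graph_iso G H"
  shows "\<exists>f. embeds f H G"
proof -
  obtain f where f: "bij_betw f (verts G) (verts H)" and E: "edges H = (\<lambda>e. f ` e) ` edges G"
    using assms(2) by (auto simp: graph_iso_def)
  let ?g = "inv_into (verts G) f"
  have g: "bij_betw ?g (verts H) (verts G)" using f by (rule bij_betw_inv_into)
  have inj: "inj_on f (verts G)" using f by (simp add: bij_betw_def)
  have "adj G (?g x) (?g y) = adj H x y" if "x \<in> verts H" "y \<in> verts H" for x y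
  proof -
    have xy: "f (?g x) = x" "f (?g y) = y" "?g x \<in> verts G" "?g y \<in> verts G"
      using f g that by (auto simp: bij_betw_inv_into_right bij_betwE)
    have "adj H x y \<longleftrightarrow> f ` {?g x, ?g y} \<in> (\<lambda>e. f ` e) ` edges G"
      by (simp add: adj_def E xy)
    also have "\<dots> \<longleftrightarrow> {?g x, ?g y} \<in> edges G"
    proof
      assume "f ` {?g x, ?g y} \<in> (\<lambda>e. f ` e) ` edges G"
      then obtain e where e: "e \<in> edges G" "f ` {?g x, ?g y} = f ` e" by blast
      have "e \<subseteq> verts G" using e(1) assms(1) by (auto simp: graphs_def)
      then have "e = {?g x, ?g y}"
        using inj_on_image_eq_iff[OF inj, of e "{?g x, ?g y}"] e(2) xy by auto
      with e show "{?g x, ?g y} \<in> edges G" by simp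
    qed (rule imageI)
    finally show ?thesis by (simp add: adj_def)
  qed
  with g have "embeds ?g H G" by (auto simp: embeds_def bij_betw_def)
  then show ?thesis by blast
qed

text \<open>For a property \<open>P\<close> this is the least induced-hereditary property containing
  \<open>P\<close>; embeddings supply the isomorphic copies of induced subgraphs.\<close>

definition hclose :: "graph set \<Rightarrow> graph set" where
  "hclose P = {G \<in> graphs. \<exists>H\<in>P. \<exists>f. embeds f G H}"

lemma hclose_mono: "P \<subseteq> Q \<Longrightarrow> hclose P \<subseteq> hclose Q"
  by (auto simp: hclose_def)

lemma hclose_superset: "graph_property P \<Longrightarrow> P \<subseteq> hclose P"
  using embeds_id by (auto simp: hclose_def property_in_graphs)

lemma graph_property_hclose: "graph_property (hclose P)"
  unfolding graph_property_def hclose_def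
  using graph_iso_embeds embeds_comp by blast

lemma induced_hereditary_hclose: "induced_hereditary (hclose P)"
  unfolding induced_hereditary_def
proof (intro ballI allI impI)
  fix G A assume "G \<in> hclose P" and A: "A \<subseteq> verts G \<and> A \<noteq> {}"
  then obtain H f where H: "G \<in> graphs" "H \<in> P" "embeds f G H" by (auto simp: hclose_def)
  then have "embeds (f \<circ> id) (induced G A) H"
    using A embeds_induced embeds_comp by blast
  with H A show "induced G A \<in> hclose P"
    by (auto simp: hclose_def induced_in_graphs)
qed

text \<open>The image of an embedding is an induced subgraph of the host, and the inverse map is an
  isomorphism back to \<open>G\<close>; \<open>P\<close> is closed under both operations.\<close>

lemma hclose_eq:
  assumes "graph_property P" "induced_hereditary P"
  shows "hclose P = P"
proof
  show "hclose P \<subseteq> P"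
  proof
    fix G assume "G \<in> hclose P"
    then obtain H f where H: "G \<in> graphs" "H \<in> P" "embeds f G H" by (auto simp: hclose_def)
    let ?A = "f ` verts G" and ?g = "inv_into (verts G) f"
    have A: "?A \<subseteq> verts H" "?A \<noteq> {}" and inj: "inj_on f (verts G)"
      using H by (auto simp: embeds_def verts_nonempty)
    have "graph_iso (induced H ?A) G"
    proof (rule graph_isoI)
      show "induced H ?A \<in> graphs"
        using A H assms(1) by (intro induced_in_graphs) (auto simp: property_in_graphs)
      show "bij_betw ?g (verts (induced H ?A)) (verts G)"
        using inj by (simp add: bij_betw_inv_into inj_on_imp_bij_betw)
      fix u v assume "u \<in> verts (induced H ?A)" "v \<in> verts (induced H ?A)" "u \<noteq> v"
      then obtain x y where "x \<in> verts G" "y \<in> verts G" "u = f x" "v = f y" "x \<noteq> y" by auto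
      then show "adj G (?g u) (?g v) = adj (induced H ?A) u v"
        using H(3) inj by (auto simp: embeds_def adj_induced)
    qed (use H in auto)
    moreover have "induced H ?A \<in> P"
      using assms(2) H(2) A unfolding induced_hereditary_def by blast
    ultimately show "G \<in> P" using assms(1) H(1) property_iso by blast
  qed
qed (rule hclose_superset[OF assms(1)])

section \<open>Algebra of the binary product\<close>

lemma gprodI:
  assumes "G \<in> graphs" "A \<union> B = verts G" "A \<inter> B = {}"
    "A = {} \<or> induced G A \<in> P" "B = {} \<or> induced G B \<in> Q"
  shows "G \<in> P \<odot> Q"
  using assms unfolding gprod_def by blast

lemma gprodE:
  assumes "G \<in> P \<odot> Q"
  obtains A B where "G \<in> graphs" "A \<union> B = verts G" "A \<inter> B = {}"
    "A = {} \<or> induced G A \<in> P" "B = {} \<or> induced G B \<in> Q"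
  using assms unfolding gprod_def by blast

lemma gprod_in_graphs: "G \<in> P \<odot> Q \<Longrightarrow> G \<in> graphs"
  by (simp add: gprod_def)

lemma gprod_commute: "P \<odot> Q = Q \<odot> P"
  by (auto simp: gprod_def Un_commute Int_commute)

lemma gprod_mono: "P \<subseteq> P' \<Longrightarrow> Q \<subseteq> Q' \<Longrightarrow> P \<odot> Q \<subseteq> P' \<odot> Q'"
  unfolding gprod_def by blast

lemma gprod_superset1:
  assumes "graph_property P"
  shows "P \<subseteq> P \<odot> Q"
proof
  fix G assume "G \<in> P"
  with assms show "G \<in> P \<odot> Q"
    by (intro gprodI[of G "verts G" "{}"]) (auto simp: property_in_graphs induced_verts)
qed

lemma gprod_superset2: "graph_property Q \<Longrightarrow> Q \<subseteq> P \<odot> Q"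
  using gprod_superset1 gprod_commute by metis

lemma gprod_empty_right:
  assumes "graph_property P"
  shows "P \<odot> {} = P"
proof
  show "P \<odot> {} \<subseteq> P"
  proof
    fix G assume "G \<in> P \<odot> {}"
    then show "G \<in> P"
      by (elim gprodE) (use induced_verts[of G] verts_nonempty[of G] in simp)
  qed
qed (rule gprod_superset1[OF assms])

lemma gprod_assoc_subset: "(P \<odot> Q) \<odot> R \<subseteq> P \<odot> (Q \<odot> R)"
proof
  fix G assume "G \<in> (P \<odot> Q) \<odot> R"
  then obtain A B where G: "G \<in> graphs" and AB: "A \<union> B = verts G" "A \<inter> B = {}"
    "A = {} \<or> induced G A \<in> P \<odot> Q" "B = {} \<or> induced G B \<in> R"
    unfolding gprod_def by blast
  obtain C D where CD: "C \<union> D = A" "C \<inter> D = {}"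
    "C = {} \<or> induced G C \<in> P" "D = {} \<or> induced G D \<in> Q"
  proof (cases "A = {}")
    case True
    then show ?thesis using that[of "{}" "{}"] by simp
  next
    case False
    with AB obtain C D where "C \<union> D = A" "C \<inter> D = {}"
      "C = {} \<or> induced (induced G A) C \<in> P" "D = {} \<or> induced (induced G A) D \<in> Q"
      unfolding gprod_def by auto
    then show ?thesis using that[of C D] by (auto simp: induced_induced)
  qed
  have "D \<union> B = {} \<or> induced G (D \<union> B) \<in> Q \<odot> R"
  proof (cases "D \<union> B = {}")
    case False
    then have "induced G (D \<union> B) \<in> graphs"
      using G AB CD by (intro induced_in_graphs) auto
    then have "induced G (D \<union> B) \<in> Q \<odot> R"
      using AB CD by (intro gprodI[of _ D B]) (auto simp: induced_induced)
    then show ?thesis ..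
  qed simp
  moreover have "C \<union> (D \<union> B) = verts G" "C \<inter> (D \<union> B) = {}" using AB CD by auto
  ultimately show "G \<in> P \<odot> (Q \<odot> R)" using G CD unfolding gprod_def by blast
qed

text \<open>Reversing the order of all three factors by commutativity turns the inclusion already
  proved into its converse.\<close>

lemma gprod_assoc: "(P \<odot> Q) \<odot> R = P \<odot> (Q \<odot> R)"
proof
  show "P \<odot> (Q \<odot> R) \<subseteq> (P \<odot> Q) \<odot> R"
    using gprod_assoc_subset[of R Q P] gprod_commute by metis
qed (rule gprod_assoc_subset)

lemma graph_property_gprod:
  assumes P: "graph_property P" and Q: "graph_property Q"
  shows "graph_property (P \<odot> Q)"
  unfolding graph_property_def
proof (intro conjI ballI impI)
  fix G H assume "G \<in> P \<odot> Q" and H: "H \<in> graphs" and iso: "graph_iso G H"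
  then obtain A B where G: "G \<in> graphs" and AB: "A \<union> B = verts G" "A \<inter> B = {}"
    "A = {} \<or> induced G A \<in> P" "B = {} \<or> induced G B \<in> Q"
    unfolding gprod_def by blast
  obtain f where f: "bij_betw f (verts G) (verts H)" and E: "edges H = (\<lambda>e. f ` e) ` edges G"
    using iso by (auto simp: graph_iso_def)
  have inj: "inj_on f (verts G)" and im: "f ` verts G = verts H"
    using f by (auto simp: bij_betw_def)
  have part: "f ` C = {} \<or> induced H (f ` C) \<in> S"
    if S: "graph_property S" and C: "C \<subseteq> verts G" "C = {} \<or> induced G C \<in> S" for C S
  proof (cases "C = {}")
    case False
    have "edges (induced H (f ` C)) = (\<lambda>e. f ` e) ` edges (induced G C)"
    proof -
      have "f ` e \<subseteq> f ` C \<longleftrightarrow> e \<subseteq> C" if "e \<in> edges G" for e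
      proof -
        have "e \<subseteq> verts G" using that G by (auto simp: graphs_def)
        with C show ?thesis
          using inj_on_image_mem_iff[OF inj] by (metis image_mono image_subset_iff subset_iff)
      qed
      then show ?thesis by (auto simp: induced_def E)
    qed
    moreover have "bij_betw f C (f ` C)"
      using inj C by (meson inj_on_imp_bij_betw inj_on_subset)
    ultimately have "graph_iso (induced G C) (induced H (f ` C))"
      unfolding graph_iso_def by auto
    moreover have "induced H (f ` C) \<in> graphs"
      using H C False im by (intro induced_in_graphs) auto
    ultimately show ?thesis using property_iso[OF S] C False by blast
  qed simp
  have "f ` A \<union> f ` B = verts H"
    using AB(1) im by (metis image_Un)
  moreover have "f ` A \<inter> f ` B = {}"
    using AB(1,2) inj_on_image_Int[OF inj, of A B] by auto
  moreover have "f ` A = {} \<or> induced H (f ` A) \<in> P" "f ` B = {} \<or> induced H (f ` B) \<in> Q"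
    using part[OF P, of A] part[OF Q, of B] AB by auto
  ultimately show "H \<in> P \<odot> Q"
    using H unfolding gprod_def by blast
qed (auto simp: gprod_def)

text \<open>A product constrains only the pairs inside a part, so the pairs between disjoint copies
  of \<open>X\<close> and \<open>Y\<close> may be coloured by an arbitrary \<open>C\<close>. Many
  later test graphs arise from a suitable choice of \<open>C\<close>.\<close>

lemma join_in_gprod:
  assumes Q: "graph_property Q" and R: "graph_property R" and X: "X \<in> Q" and Y: "Y \<in> R"
  obtains G f g where "G \<in> Q \<odot> R" "embeds f X G" "embeds g Y G"
    "f ` verts X \<inter> g ` verts Y = {}"
    "\<And>x y. x \<in> verts X \<Longrightarrow> y \<in> verts Y \<Longrightarrow> adj G (f x) (g y) = C x y"
proof -
  have gX: "X \<in> graphs" and gY: "Y \<in> graphs" using assms property_in_graphs by auto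
  define f g :: "nat \<Rightarrow> nat" where "f = (\<lambda>n. 2 * n)" and "g = (\<lambda>n. 2 * n + 1)"
  define V where "V = f ` verts X \<union> g ` verts Y"
  \<comment> \<open>Even numbers carry \<open>X\<close> and odd numbers carry \<open>Y\<close>; both
    mixed cases hand the vertex of \<open>X\<close> to \<open>C\<close> first, which makes
    \<open>D\<close> symmetric.\<close>
  define D where "D u v =
    (if even u then if even v then adj X (u div 2) (v div 2) else C (u div 2) (v div 2)
     else if even v then C (v div 2) (u div 2) else adj Y (u div 2) (v div 2))" for u v
  define G where "G = mkgraph V D"
  have G: "G \<in> graphs"
    unfolding G_def V_def using gX gY by (intro mkgraph_in_graphs) (auto simp: finite_verts verts_nonempty)
  have sym: "D u v = D v u" for u v
    by (simp add: D_def adj_commute)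
  have adjG: "adj G u v = D u v" if "u \<in> V" "v \<in> V" "u \<noteq> v" for u v
    unfolding G_def using that sym by (rule adj_mkgraph)
  have inj: "inj f" "inj g" by (auto simp: f_def g_def inj_def)
  have disj: "f ` verts X \<inter> g ` verts Y = {}"
    by (auto simp: f_def g_def) presburger
  have fX: "adj G (f x) (f y) = adj X x y" if "x \<in> verts X" "y \<in> verts X" "x \<noteq> y" for x y
    using that by (subst adjG) (auto simp: V_def D_def f_def)
  have gYY: "adj G (g x) (g y) = adj Y x y" if "x \<in> verts Y" "y \<in> verts Y" "x \<noteq> y" for x y
    using that by (subst adjG) (auto simp: V_def D_def g_def)
  have cross: "adj G (f x) (g y) = C x y" if "x \<in> verts X" "y \<in> verts Y" for x y
    using that disj by (subst adjG) (auto simp: V_def D_def f_def g_def)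
  have VG: "verts G = V" by (simp add: G_def)
  have part: "induced G (h ` verts Z) \<in> S"
    if "graph_property S" "Z \<in> S" "inj h" "h ` verts Z \<subseteq> V"
      "\<And>x y. x \<in> verts Z \<Longrightarrow> y \<in> verts Z \<Longrightarrow> x \<noteq> y \<Longrightarrow> adj G (h x) (h y) = adj Z x y" for h Z S
  proof (rule property_iso[OF that(1,2)])
    have gZ: "Z \<in> graphs" using that property_in_graphs by blast
    show gI: "induced G (h ` verts Z) \<in> graphs"
      using G that gZ by (intro induced_in_graphs) (auto simp: VG verts_nonempty)
    show "graph_iso Z (induced G (h ` verts Z))"
      by (rule graph_isoI[OF gZ gI, of h])
        (use that in \<open>auto simp: adj_induced intro: inj_on_subset inj_on_imp_bij_betw\<close>)
  qed
  have "induced G (f ` verts X) \<in> Q" "induced G (g ` verts Y) \<in> R"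
    using part[OF Q X inj(1)] part[OF R Y inj(2)] fX gYY by (auto simp: V_def)
  then have "G \<in> Q \<odot> R"
    using G disj unfolding gprod_def by (auto simp: VG V_def)
  moreover have "embeds f X G" "embeds g Y G"
    using inj fX gYY by (auto simp: embeds_def VG V_def intro: inj_on_subset)
  ultimately show ?thesis using that disj cross by blast
qed

text \<open>If the two parts of \<open>G\<close> embed into \<open>X\<close> and \<open>Y\<close>,
  then \<open>G\<close> embeds into a join of \<open>X\<close> and \<open>Y\<close> whose cross
  pairs are copied from \<open>G\<close>.\<close>

lemma hclose_gprod_hclose:
  assumes Q: "graph_property Q" and R: "graph_property R"
  shows "hclose Q \<odot> hclose R \<subseteq> hclose (Q \<odot> R)"
proof
  fix G assume "G \<in> hclose Q \<odot> hclose R"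
  then obtain A B where G: "G \<in> graphs" and AB: "A \<union> B = verts G" "A \<inter> B = {}"
    "A = {} \<or> induced G A \<in> hclose Q" "B = {} \<or> induced G B \<in> hclose R"
    unfolding gprod_def by blast
  consider "A = {}" | "B = {}" | "A \<noteq> {}" "B \<noteq> {}" by blast
  then show "G \<in> hclose (Q \<odot> R)"
  proof cases
    case 1
    then have "G \<in> hclose R" using AB G by (auto simp: induced_verts verts_nonempty)
    then show ?thesis using hclose_mono gprod_superset2[OF R] by blast
  next
    case 2
    then have "G \<in> hclose Q" using AB G by (auto simp: induced_verts verts_nonempty)
    then show ?thesis using hclose_mono gprod_superset1[OF Q] by blast
  next
    case 3
    with AB obtain X Y f g where X: "X \<in> Q" "embeds f (induced G A) X"
      and Y: "Y \<in> R" "embeds g (induced G B) Y"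
      by (auto simp: hclose_def)
    have f: "inj_on f A" "f ` A \<subseteq> verts X"
      and g: "inj_on g B" "g ` B \<subseteq> verts Y" using X Y by (auto simp: embeds_def)
    \<comment> \<open>Pulling cross pairs back through the inverses of \<open>f\<close> and
      \<open>g\<close> gives the pairs between the images of \<open>A\<close> and \<open>B\<close>
      the colours they have in \<open>G\<close>.\<close>
    obtain H i j where H: "H \<in> Q \<odot> R" and i: "embeds i X H" and j: "embeds j Y H"
      and disj: "i ` verts X \<inter> j ` verts Y = {}"
      and cross: "\<And>x y. x \<in> verts X \<Longrightarrow> y \<in> verts Y \<Longrightarrow>
        adj H (i x) (j y) = adj G (inv_into A f x) (inv_into B g y)"
      using join_in_gprod[OF Q R X(1) Y(1), where C = "\<lambda>x y. adj G (inv_into A f x) (inv_into B g y)"]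
      by metis
    define h where "h v = (if v \<in> A then i (f v) else j (g v))" for v
    have hA: "embeds (i \<circ> f) (induced G A) H" using X i embeds_comp by blast
    have hB: "embeds (j \<circ> g) (induced G B) H" using Y j embeds_comp by blast
    have hAB: "adj H (h u) (h v) = adj G u v" if "u \<in> A" "v \<in> B" for u v
    proof -
      have "v \<notin> A" using that AB by auto
      then have "adj H (h u) (h v) = adj G (inv_into A f (f u)) (inv_into B g (g v))"
        using cross[of "f u" "g v"] f g that by (auto simp: h_def)
      then show ?thesis using f g that by simp
    qed
    have ne: "h u \<noteq> h v" if "u \<in> A" "v \<in> B" for u v
    proof -
      have "v \<notin> A" using that AB by auto
      moreover have "f u \<in> verts X" "g v \<in> verts Y" using that f g by auto
      ultimately show ?thesis using that disj by (auto simp: h_def)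
    qed
    have iA: "inj_on h A" "h ` A \<subseteq> verts H"
      "\<And>u v. u \<in> A \<Longrightarrow> v \<in> A \<Longrightarrow> u \<noteq> v \<Longrightarrow> adj H (h u) (h v) = adj G u v"
      using hA by (auto simp: embeds_def h_def inj_on_def adj_induced)
    have "h v = (j \<circ> g) v" if "v \<in> B" for v using that AB by (auto simp: h_def)
    then have iB: "inj_on h B" "h ` B \<subseteq> verts H"
      "\<And>u v. u \<in> B \<Longrightarrow> v \<in> B \<Longrightarrow> u \<noteq> v \<Longrightarrow> adj H (h u) (h v) = adj G u v"
      using hB by (auto simp: embeds_def inj_on_def adj_induced)
    have "inj_on h (A \<union> B)" unfolding inj_on_Un using iA iB ne by blast
    moreover have "adj H (h u) (h v) = adj G u v" if "u \<in> A \<union> B" "v \<in> A \<union> B" "u \<noteq> v" for u v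
      using that iA iB hAB adj_commute by (metis UnE)
    ultimately have "embeds h G H"
      using iA(2) iB(2) AB(1) unfolding embeds_def by (metis image_Un Un_least)
    then show ?thesis using G H by (auto simp: hclose_def)
  qed
qed

section \<open>Factorisations and cancellation\<close>

lemma gprods_Nil: "gprods [] = {}"
  by (auto simp: gprods_def graphs_def)

text \<open>Merging all parts but the first, or prepending a part to an indexed family, shifts the
  indices by one. This opens the way to induction on the list with the binary product.\<close>

lemma gprods_Cons: "gprods (P # Ps) = P \<odot> gprods Ps"
proof (intro set_eqI iffI)
  fix G assume "G \<in> gprods (P # Ps)"
  then obtain A where G: "G \<in> graphs" and A: "(\<Union>i<Suc (length Ps). A i) = verts G"
    "disjoint_family_on A {..<Suc (length Ps)}"
    "\<And>i. i < Suc (length Ps) \<Longrightarrow> A i = {} \<or> induced G (A i) \<in> (P # Ps) ! i"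
    by (auto simp: gprods_def)
  let ?B = "\<Union>i<length Ps. A (Suc i)"
  show "G \<in> P \<odot> gprods Ps"
  proof (rule gprodI[OF G, of "A 0" ?B])
    show U: "A 0 \<union> ?B = verts G"
      unfolding A(1)[symmetric] by (auto simp: lessThan_Suc_eq_insert_0)
    show "A 0 \<inter> ?B = {}"
      using A(2) by (force simp: disjoint_family_on_def)
    show "A 0 = {} \<or> induced G (A 0) \<in> P" using A(3)[of 0] by simp
    show "?B = {} \<or> induced G ?B \<in> gprods Ps"
    proof (cases "?B = {}")
      case False
      have "induced G ?B \<in> graphs"
        using U False by (intro induced_in_graphs[OF G]) auto
      moreover have "disjoint_family_on (A \<circ> Suc) {..<length Ps}"
        using A(2) by (force simp: disjoint_family_on_def)
      moreover have "(A \<circ> Suc) i = {} \<or> induced (induced G ?B) ((A \<circ> Suc) i) \<in> Ps ! i"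
        if "i < length Ps" for i
      proof -
        have "A (Suc i) \<subseteq> ?B" using that by blast
        then show ?thesis using A(3)[of "Suc i"] that by (simp add: induced_induced)
      qed
      ultimately have "induced G ?B \<in> gprods Ps"
        unfolding gprods_def by (intro CollectI conjI exI[of _ "A \<circ> Suc"]) auto
      then show ?thesis ..
    qed simp
  qed
next
  fix G assume "G \<in> P \<odot> gprods Ps"
  then obtain A B where G: "G \<in> graphs" and AB: "A \<union> B = verts G" "A \<inter> B = {}"
    "A = {} \<or> induced G A \<in> P" "B = {} \<or> induced G B \<in> gprods Ps"
    by (elim gprodE)
  obtain D where D: "(\<Union>i<length Ps. D i) = B" "disjoint_family_on D {..<length Ps}"
    "\<And>i. i < length Ps \<Longrightarrow> D i = {} \<or> induced G (D i) \<in> Ps ! i"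
  proof (cases "B = {}")
    case True
    then show ?thesis using that[of "\<lambda>_. {}"] by (simp add: disjoint_family_on_def)
  next
    case False
    with AB(4) obtain D where D: "(\<Union>i<length Ps. D i) = B" "disjoint_family_on D {..<length Ps}"
      "\<And>i. i < length Ps \<Longrightarrow> D i = {} \<or> induced (induced G B) (D i) \<in> Ps ! i"
      by (auto simp: gprods_def)
    have "D i \<subseteq> B" if "i < length Ps" for i using D(1) that by blast
    with D show ?thesis using that[of D] by (metis induced_induced)
  qed
  define E where "E = case_nat A D"
  have "(\<Union>i<Suc (length Ps). E i) = verts G"
    using AB(1) D(1) by (simp add: lessThan_Suc_eq_insert_0 E_def)
  moreover have "disjoint_family_on E {..<Suc (length Ps)}"
  proof -
    have "E i \<inter> E j = {}" if ij: "i < Suc (length Ps)" "j < Suc (length Ps)" "i < j" for i j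
    proof (cases i)
      case 0
      then obtain k where "j = Suc k" "k < length Ps" using ij by (cases j) auto
      then show ?thesis using 0 AB(2) D(1) by (auto simp: E_def)
    next
      case (Suc m)
      then obtain k where "j = Suc k" "k < length Ps" "m \<noteq> k" using ij by (cases j) auto
      then show ?thesis using Suc ij D(2) by (auto simp: E_def disjoint_family_on_def)
    qed
    then show ?thesis unfolding disjoint_family_on_def
      by (metis Int_commute lessThan_iff linorder_neqE_nat)
  qed
  moreover have "E i = {} \<or> induced G (E i) \<in> (P # Ps) ! i" if "i < Suc (length Ps)" for i
    using that AB(3) D(3) by (cases i) (auto simp: E_def)
  ultimately show "G \<in> gprods (P # Ps)"
    unfolding gprods_def using G by (intro CollectI conjI exI[of _ E]) auto
qed

lemma graph_property_empty: "graph_property {}"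
  by (simp add: graph_property_def)

lemma graph_property_gprods: "(\<And>P. P \<in> set Ps \<Longrightarrow> graph_property P) \<Longrightarrow> graph_property (gprods Ps)"
  by (induction Ps) (auto simp: gprods_Nil gprods_Cons graph_property_empty graph_property_gprod)

lemma gprods_singleton: "graph_property P \<Longrightarrow> gprods [P] = P"
  by (simp add: gprods_Cons gprods_Nil gprod_empty_right)

lemma gprods_append:
  assumes "\<And>Q. Q \<in> set Qs \<Longrightarrow> graph_property Q"
  shows "gprods (Ps @ Qs) = gprods Ps \<odot> gprods Qs"
proof (induction Ps)
  case Nil
  have "{} \<odot> gprods Qs = gprods Qs"
    using assms gprod_commute gprod_empty_right graph_property_gprods by metis
  then show ?case by (simp add: gprods_Nil)
qed (simp add: gprods_Cons gprod_assoc)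

text \<open>Left commutativity makes \<open>gprods\<close> a fold over a multiset. Uniqueness is an
  equality of multisets, which is thereby turned into an equality of properties.\<close>

lemma gprods_cong_mset:
  assumes "mset Ps = mset Qs"
  shows "gprods Ps = gprods Qs"
proof -
  have left_commute: "P \<odot> (Q \<odot> R) = Q \<odot> (P \<odot> R)" for P Q R
    using gprod_assoc[of P Q R] gprod_assoc[of Q P R] gprod_commute[of P Q] by simp
  interpret comp_fun_commute "(\<odot>)"
    by (unfold_locales, intro ext, unfold comp_apply, rule left_commute)
  have "gprods Rs = fold_mset (\<odot>) {} (mset Rs)" for Rs
    by (induction Rs) (simp_all add: gprods_Nil gprods_Cons)
  with assms show ?thesis by simp
qed

lemma gprod_nonempty: "graph_property P \<Longrightarrow> P \<noteq> {} \<Longrightarrow> P \<odot> Q \<noteq> {}"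
  using gprod_superset1 by blast

lemma gprods_nonempty:
  assumes "\<And>P. P \<in> set Ps \<Longrightarrow> graph_property P" "Ps \<noteq> []" "{} \<notin> set Ps"
  shows "gprods Ps \<noteq> {}"
proof (cases Ps)
  case (Cons P Qs)
  then have "graph_property P" "P \<noteq> {}" using assms by auto
  then show ?thesis using Cons gprod_nonempty by (simp add: gprods_Cons)
qed (use assms in simp)

section \<open>Elementary facts on factorisations\<close>

lemma factorisation_property: "factorisation Ps P \<Longrightarrow> Q \<in> set Ps \<Longrightarrow> graph_property Q"
  by (auto simp: factorisation_def irreducible_property_def)

text \<open>\<open>factorisation\<close> bans \<open>{}\<close> only from lists of length at least
  two; a single factor equals \<open>P\<close> itself.\<close>

lemma factorisation_nonempty:
  assumes "factorisation Ps P" "P \<noteq> {}"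
  shows "{} \<notin> set Ps"
proof (cases "length Ps > 1")
  case False
  with assms(1) obtain Q where Q: "Ps = [Q]"
    by (cases Ps) (auto simp: factorisation_def)
  then have "P = Q"
    using assms(1) gprods_singleton[of Q] factorisation_property[OF assms(1), of Q]
    by (simp add: factorisation_def)
  with Q assms(2) show ?thesis by simp
qed (use assms in \<open>simp add: factorisation_def\<close>)

lemma factorisation_append:
  assumes "factorisation Ps P" "factorisation Qs Q" "P \<noteq> {}" "Q \<noteq> {}"
  shows "factorisation (Ps @ Qs) (P \<odot> Q)"
  using assms gprods_append[of Qs Ps] factorisation_nonempty[of Ps P] factorisation_nonempty[of Qs Q]
  by (auto simp: factorisation_def irreducible_property_def)

lemma factorisation_singleton: "irreducible_property P \<Longrightarrow> factorisation [P] P"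
  by (simp add: factorisation_def gprods_singleton irreducible_property_def)

text \<open>Grouping all factors but the first turns every longer factorisation into a product of
  two nonempty properties, to which the results on two factors apply.\<close>

lemma factorisation_cases:
  assumes "factorisation Ps P"
  obtains "Ps = [P]" "irreducible_property P"
  | Q Qs where "Ps = Q # Qs" "P = Q \<odot> gprods Qs" "Qs \<noteq> []" "graph_property Q" "Q \<noteq> {}"
    "graph_property (gprods Qs)" "gprods Qs \<noteq> {}"
proof -
  obtain Q Qs where Ps: "Ps = Q # Qs" using assms by (cases Ps) (auto simp: factorisation_def)
  have gp: "graph_property R" if "R \<in> set Ps" for R using factorisation_property[OF assms that] .
  show ?thesis
  proof (cases "Qs = []")
    case True
    then have "P = Q" using assms gprods_singleton[of Q] gp[of Q] Ps by (simp add: factorisation_def)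
    then show ?thesis using that(1) True Ps assms by (simp add: factorisation_def)
  next
    case False
    then have "{} \<notin> set Ps" using assms Ps by (auto simp: factorisation_def)
    then show ?thesis
      using that(2)[OF Ps _ False] assms gp Ps False gprods_nonempty[of Qs] graph_property_gprods[of Qs]
      by (auto simp: factorisation_def gprods_Cons)
  qed
qed

section \<open>Universality as a measure that bounds the number of factors\<close>

definition universal :: "nat \<Rightarrow> graph set \<Rightarrow> bool" where
  "universal k P \<longleftrightarrow> {G \<in> graphs. card (verts G) = k} \<subseteq> hclose P"

lemma universal_mono: "P \<subseteq> Q \<Longrightarrow> universal k P \<Longrightarrow> universal k Q"
  unfolding universal_def using hclose_mono by blast

lemma universal_0: "universal 0 P"
  using card_verts_pos by (force simp: universal_def)

lemma singleton_in_hclose: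
  assumes "graph_property P" "P \<noteq> {}" "G \<in> graphs" "verts G = {v}"
  shows "G \<in> hclose P"
proof -
  obtain H where H: "H \<in> P" using assms by blast
  then obtain w where "w \<in> verts H" using assms(1) property_in_graphs verts_nonempty by blast
  then have "embeds (\<lambda>_. w) G H" using assms(4) by (simp add: embeds_def)
  with H assms(3) show ?thesis by (auto simp: hclose_def)
qed

text \<open>One vertex of \<open>G\<close> is left to \<open>R\<close> and the other
  \<open>k\<close> embed into a member of \<open>Q\<close>; the product of the closures lies in the
  closure of the product. Thus each nonempty factor raises the level by one.\<close>

lemma universal_Suc:
  assumes Q: "graph_property Q" and R: "graph_property R" "R \<noteq> {}" and k: "universal k Q"
  shows "universal (Suc k) (Q \<odot> R)"
  unfolding universal_def
proof
  fix G assume "G \<in> {G \<in> graphs. card (verts G) = Suc k}"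
  then have G: "G \<in> graphs" "card (verts G) = Suc k" by auto
  obtain v where v: "v \<in> verts G" using verts_nonempty G by blast
  have "G \<in> hclose Q \<odot> hclose R"
  proof (rule gprodI[OF G(1), of "verts G - {v}" "{v}"])
    show "verts G - {v} = {} \<or> induced G (verts G - {v}) \<in> hclose Q"
    proof (cases "verts G - {v} = {}")
      case False
      then have "induced G (verts G - {v}) \<in> graphs"
        using G(1) by (intro induced_in_graphs) auto
      moreover have "card (verts G - {v}) = k" using G v by (simp add: finite_verts)
      ultimately show ?thesis using k by (auto simp: universal_def)
    qed simp
    show "{v} = {} \<or> induced G {v} \<in> hclose R"
      using R v G by (auto intro!: singleton_in_hclose induced_in_graphs)
  qed (use v in auto)
  then show "G \<in> hclose (Q \<odot> R)" using hclose_gprod_hclose[OF Q R(1)] by blast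
qed

lemma universal_imp_all:
  assumes "graph_property P" "induced_hereditary P" "\<And>k. universal k P"
  shows "P = graphs"
  using assms hclose_eq[OF assms(1,2)] property_in_graphs by (auto simp: universal_def)

text \<open>Each use of \<open>P = P \<odot> R\<close> raises the level at which \<open>P\<close> is
  universal by one, starting from the vacuous level 0.\<close>

lemma absorbing_imp_all:
  assumes "graph_property P" "induced_hereditary P" "graph_property R" "R \<noteq> {}" "P = P \<odot> R"
  shows "P = graphs"
proof (rule universal_imp_all[OF assms(1,2)])
  show "universal k P" for k
    by (induction k) (use universal_0 universal_Suc assms in metis)+
qed

text \<open>If one factor were \<open>{}\<close>, the identity of the product, the other would be
  \<open>P\<close>, which reducibility excludes.\<close>

lemma reducibleE:
  assumes "graph_property P" "\<not> irreducible_property P"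
  obtains Q R where "graph_property Q" "graph_property R" "Q \<noteq> {}" "R \<noteq> {}" "P = Q \<odot> R"
proof -
  obtain Q R where QR: "graph_property Q" "graph_property R" "Q \<noteq> P" "R \<noteq> P" "P = Q \<odot> R"
    using assms by (auto simp: irreducible_property_def reducible_property_def)
  moreover have "Q \<noteq> {}" "R \<noteq> {}"
    using QR gprod_empty_right gprod_commute by metis+
  ultimately show ?thesis using that by blast
qed

text \<open>Each splitting of a property strictly lowers the least \<open>k\<close> for which it is not universal.\<close>

lemma factorisation_exists:
  assumes "graph_property P" "P \<noteq> {}" "\<not> universal k P"
  shows "\<exists>Ps. factorisation Ps P"
  using assms
proof (induction k arbitrary: P)
  case 0
  then show ?case using universal_0 by blast
next
  case (Suc k)
  show ?case
  proof (cases "irreducible_property P")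
    case True
    then show ?thesis using factorisation_singleton by blast
  next
    case False
    then obtain Q R where QR: "graph_property Q" "graph_property R" "Q \<noteq> {}" "R \<noteq> {}" "P = Q \<odot> R"
      using reducibleE Suc.prems(1) by metis
    then have "\<not> universal k Q" "\<not> universal k R"
      using universal_Suc[of Q R k] universal_Suc[of R Q k] Suc.prems(3) gprod_commute[of Q R] by auto
    then obtain Qs Rs where "factorisation Qs Q" "factorisation Rs R"
      using Suc.IH QR by blast
    then show ?thesis using factorisation_append QR by blast
  qed
qed

section \<open>Cancellation and the critical graph\<close>

definition cancellable :: "graph set \<Rightarrow> graph set \<Rightarrow> bool" where
  "cancellable Q R \<longleftrightarrow>
     (\<forall>Q'. graph_property Q' \<longrightarrow> Q' \<noteq> {} \<longrightarrow> Q' \<odot> R = Q \<odot> R \<longrightarrow> Q' = Q)"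

text \<open>Since \<open>P\<close> is not universal at some level, its subproperties
  \<open>Q\<close>, \<open>Q'\<close> and \<open>R\<close> all have factorisations. Appending the
  same factorisation of \<open>R\<close> to those of \<open>Q\<close> and \<open>Q'\<close> gives
  two factorisations of \<open>P\<close>, whose common part cancels as a multiset.\<close>

lemma unique_factorisation_cancellable:
  assumes P: "graph_property P" "induced_hereditary P" "P \<noteq> graphs" and uniq: "unique_factorisation P"
    and Q: "graph_property Q" "Q \<noteq> {}" and R: "graph_property R" "R \<noteq> {}" and eq: "P = Q \<odot> R"
  shows "cancellable Q R"
  unfolding cancellable_def
proof (intro allI impI)
  fix Q' assume Q': "graph_property Q'" "Q' \<noteq> {}" "Q' \<odot> R = Q \<odot> R"
  obtain k where k: "\<not> universal k P" using universal_imp_all P by blast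
  have ex: "\<exists>Ss. factorisation Ss S" if "graph_property S" "S \<noteq> {}" "S \<subseteq> P" for S
    using factorisation_exists universal_mono k that by blast
  have "Q \<subseteq> P" "Q' \<subseteq> P" "R \<subseteq> P"
    using gprod_superset1[OF Q(1), of R] gprod_superset1[OF Q'(1), of R]
      gprod_superset2[OF R(1), of Q] eq Q'(3) by auto
  with ex Q Q' R obtain Fs Fs' Gs where F: "factorisation Fs Q" "factorisation Fs' Q'" "factorisation Gs R"
    by metis
  have "factorisation (Fs @ Gs) P" "factorisation (Fs' @ Gs) P"
    using factorisation_append[OF F(1,3)] factorisation_append[OF F(2,3)] Q Q' R eq by auto
  then have "mset (Fs @ Gs) = mset (Fs' @ Gs)"
    using uniq unfolding unique_factorisation_def by metis
  then have "mset Fs = mset Fs'" by simp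
  then have "gprods Fs = gprods Fs'" by (rule gprods_cong_mset)
  then show "Q' = Q" using F by (simp add: factorisation_def)
qed

text \<open>\<open>hclose Q\<close> is the competitor of \<open>Q\<close>: its product with
  \<open>R\<close> lies in \<open>hclose P = P\<close>.\<close>

lemma cancellable_imp_hereditary:
  assumes P: "graph_property P" "induced_hereditary P"
    and Q: "graph_property Q" "Q \<noteq> {}" and R: "graph_property R" and eq: "P = Q \<odot> R"
    and cancel: "cancellable Q R"
  shows "induced_hereditary Q"
proof -
  have "hclose Q \<odot> R \<subseteq> hclose Q \<odot> hclose R"
    by (intro gprod_mono hclose_superset R) simp
  also have "\<dots> \<subseteq> hclose P" using hclose_gprod_hclose[OF Q(1) R] eq by simp
  also have "\<dots> = P" using P by (rule hclose_eq)
  finally have "hclose Q \<odot> R = Q \<odot> R"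
    using gprod_mono[OF hclose_superset[OF Q(1)], of R R] eq by auto
  moreover have "hclose Q \<noteq> {}" using hclose_superset Q by blast
  ultimately have "hclose Q = Q"
    using cancel graph_property_hclose unfolding cancellable_def by blast
  then show ?thesis using induced_hereditary_hclose by metis
qed

lemma graph_property_card_filter:
  assumes "graph_property P"
  shows "graph_property {G \<in> P. F (card (verts G))}"
proof -
  have "card (verts H) = card (verts G)" if "graph_iso G H" for G H
    using that bij_betw_same_card unfolding graph_iso_def by metis
  then show ?thesis using assms unfolding graph_property_def by auto
qed

text \<open>If no such \<open>G\<close> existed, the one-vertex graphs could be removed from \<open>Q\<close> without changing
  the product.\<close>

lemma cancellable_critical_graph:
  assumes Q: "graph_property Q" "induced_hereditary Q" and R: "graph_property R" "induced_hereditary R" "R \<noteq> {}"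
    and cancel: "cancellable Q R" and X: "X \<in> Q" "card (verts X) \<noteq> 1"
  obtains G v where "G \<in> graphs" "v \<in> verts G" "verts G \<noteq> {v}" "induced G (verts G - {v}) \<in> R" "G \<notin> R"
    "\<And>u. u \<in> verts G \<Longrightarrow> u \<noteq> v \<Longrightarrow> induced G {u, v} \<notin> Q"
proof (rule ccontr)
  assume "\<not> thesis"
  note critical = that
  have none: "G \<in> R \<or> (\<exists>u\<in>verts G. u \<noteq> v \<and> induced G {u, v} \<in> Q)"
    if "G \<in> graphs" "v \<in> verts G" "verts G \<noteq> {v}" "induced G (verts G - {v}) \<in> R" for G v
    using critical[OF that] \<open>\<not> thesis\<close> by blast
  define Q' where "Q' = {G \<in> Q. card (verts G) \<noteq> 1}"
  have gQ': "graph_property Q'"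
    unfolding Q'_def using graph_property_card_filter[OF Q(1), of "\<lambda>n. n \<noteq> 1"] by simp
  have "Q \<odot> R \<subseteq> Q' \<odot> R"
  proof
    fix G assume "G \<in> Q \<odot> R"
    then obtain A B where G: "G \<in> graphs" and AB: "A \<union> B = verts G" "A \<inter> B = {}"
      "A = {} \<or> induced G A \<in> Q" "B = {} \<or> induced G B \<in> R"
      by (elim gprodE)
    show "G \<in> Q' \<odot> R"
    proof (cases "card A = 1")
      case False
      then show ?thesis using AB G by (intro gprodI[of G A B]) (auto simp: Q'_def)
    next
      case True
      then obtain v where v: "A = {v}" by (auto simp: card_1_singleton_iff)
      have "G \<in> R \<or> (\<exists>u\<in>verts G. u \<noteq> v \<and> induced G {u, v} \<in> Q)"
      proof (cases "B = {}")
        case True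
        then have "G \<in> R"
          using singleton_in_hclose[OF R(1,3) G, of v] hclose_eq[OF R(1,2)] AB v by simp
        then show ?thesis ..
      next
        case False
        moreover have "B = verts G - {v}" using AB v by auto
        ultimately show ?thesis using none[OF G, of v] AB v by auto
      qed
      then show ?thesis
      proof (elim disjE bexE conjE)
        assume "G \<in> R"
        then show ?thesis using gprod_superset2[OF R(1)] by blast
      next
        fix u assume u: "u \<in> verts G" "u \<noteq> v" "induced G {u, v} \<in> Q"
        then have uB: "u \<in> B" using AB v by auto
        \<comment> \<open>Moving \<open>u\<close> from \<open>B\<close> to the first part replaces
          the one-vertex graph by a two-vertex graph in \<open>Q'\<close>; the rest of
          \<open>B\<close> stays in \<open>R\<close> by heredity.\<close>
        show ?thesis
        proof (rule gprodI[OF G, of "{u, v}" "B - {u}"])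
          have "induced (induced G B) (B - {u}) \<in> R" if "B - {u} \<noteq> {}"
          proof -
            have "induced G B \<in> R" using AB uB by auto
            then show ?thesis using that R(2) unfolding induced_hereditary_def by simp
          qed
          then show "B - {u} = {} \<or> induced G (B - {u}) \<in> R"
            by (auto simp: induced_induced)
        qed (use u uB AB v in \<open>auto simp: Q'_def\<close>)
      qed
    qed
  qed
  moreover have "Q' \<odot> R \<subseteq> Q \<odot> R" by (intro gprod_mono) (auto simp: Q'_def)
  \<comment> \<open>\<open>X\<close> survives the removal, so \<open>Q'\<close> is nonempty, as
    cancellation demands; the one-vertex subgraphs of \<open>X\<close> then separate
    \<open>Q\<close> from \<open>Q'\<close>.\<close>
  moreover have "X \<in> Q'" using X by (simp add: Q'_def)
  ultimately have "Q' = Q" using cancel gQ' unfolding cancellable_def by blast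
  moreover obtain x where x: "x \<in> verts X" using X Q(1) property_in_graphs verts_nonempty by blast
  then have "induced X {x} \<in> Q" using X Q(2) unfolding induced_hereditary_def by auto
  moreover have "induced X {x} \<notin> Q'" by (simp add: Q'_def)
  ultimately show False by simp
qed

section \<open>Monochromatic factors\<close>

text \<open>A one-vertex graph has both colours, so the bound 1 needs separate treatment wherever a
  colour is to be read off.\<close>

definition monochromatic :: "bool \<Rightarrow> graph \<Rightarrow> bool" where
  "monochromatic c G \<longleftrightarrow> (\<forall>u\<in>verts G. \<forall>v\<in>verts G. u \<noteq> v \<longrightarrow> adj G u v = c)"

definition mono_upto :: "bool \<Rightarrow> enat \<Rightarrow> graph set" where
  "mono_upto c s = {G \<in> graphs. monochromatic c G \<and> enat (card (verts G)) \<le> s}"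

lemma monochromaticD:
  "monochromatic c G \<Longrightarrow> u \<in> verts G \<Longrightarrow> v \<in> verts G \<Longrightarrow> u \<noteq> v \<Longrightarrow> adj G u v = c"
  by (auto simp: monochromatic_def)

lemma monochromatic_induced_iff:
  "monochromatic c (induced G A) \<longleftrightarrow> (\<forall>u\<in>A. \<forall>v\<in>A. u \<noteq> v \<longrightarrow> adj G u v = c)"
  by (simp add: monochromatic_def adj_induced)

lemma mono_uptoD:
  assumes "G \<in> mono_upto c s"
  shows "G \<in> graphs" "monochromatic c G" "enat (card (verts G)) \<le> s"
  using assms by (simp_all add: mono_upto_def)

lemma edgeless_upto_eq_mono_upto: "edgeless_upto s = mono_upto False s"
proof -
  have "edges G = {} \<longleftrightarrow> monochromatic False G" if "G \<in> graphs" for G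
    using edges_conv_adj[OF that] by (auto simp: monochromatic_def)
  then show ?thesis by (auto simp: edgeless_upto_def mono_upto_def)
qed

lemma complete_upto_eq_mono_upto: "complete_upto s = mono_upto True s"
proof -
  have "edges G = {e. e \<subseteq> verts G \<and> card e = 2} \<longleftrightarrow> monochromatic True G" if G: "G \<in> graphs" for G
  proof
    assume E: "edges G = {e. e \<subseteq> verts G \<and> card e = 2}"
    show "monochromatic True G"
      unfolding monochromatic_def adj_def E by auto
  next
    assume "monochromatic True G"
    then have "e \<in> edges G" if "e \<subseteq> verts G" "card e = 2" for e
      using that by (auto simp: card_2_iff monochromatic_def adj_def)
    then show "edges G = {e. e \<subseteq> verts G \<and> card e = 2}"
      using G by (auto simp: graphs_def)
  qed
  then show ?thesis by (auto simp: complete_upto_def mono_upto_def)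
qed

lemma embeds_monochromatic:
  assumes "embeds f G H" "monochromatic c H"
  shows "monochromatic c G"
  unfolding monochromatic_def
proof (intro ballI impI)
  fix u v assume uv: "u \<in> verts G" "v \<in> verts G" "u \<noteq> v"
  then have "f u \<noteq> f v" "f u \<in> verts H" "f v \<in> verts H" "adj H (f u) (f v) = adj G u v"
    using assms(1) by (auto simp: embeds_def inj_on_def)
  then show "adj G u v = c" using assms(2) monochromaticD by blast
qed

lemma embeds_card_le:
  assumes "embeds f G H" "H \<in> graphs"
  shows "card (verts G) \<le> card (verts H)"
  using assms by (meson card_inj_on_le embeds_def finite_verts)

text \<open>A fixed point of \<open>hclose\<close> is closed under isomorphism and
  induced-hereditary, so both facts come from this one equation.\<close>

lemma hclose_mono_upto: "hclose (mono_upto c s) = mono_upto c s"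
proof
  show "hclose (mono_upto c s) \<subseteq> mono_upto c s"
  proof
    fix G assume "G \<in> hclose (mono_upto c s)"
    then obtain H f where H: "G \<in> graphs" "H \<in> mono_upto c s" "embeds f G H"
      by (auto simp: hclose_def)
    then have "enat (card (verts G)) \<le> enat (card (verts H))"
      using embeds_card_le by (auto simp: mono_upto_def)
    also have "\<dots> \<le> s" using H(2) by (rule mono_uptoD)
    finally show "G \<in> mono_upto c s"
      using H embeds_monochromatic by (auto simp: mono_upto_def)
  qed
  show "mono_upto c s \<subseteq> hclose (mono_upto c s)"
    unfolding hclose_def using embeds_id mono_uptoD(1) by blast
qed

lemma graph_property_mono_upto: "graph_property (mono_upto c s)"
  using graph_property_hclose[of "mono_upto c s"] by (simp add: hclose_mono_upto)

lemma induced_hereditary_mono_upto: "induced_hereditary (mono_upto c s)"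
  using induced_hereditary_hclose[of "mono_upto c s"] by (simp add: hclose_mono_upto)

lemma ex_monochromatic:
  assumes "1 \<le> n"
  obtains G where "G \<in> graphs" "monochromatic c G" "card (verts G) = n"
proof (rule that[of "mkgraph {..<n} (\<lambda>_ _. c)"])
  show "mkgraph {..<n} (\<lambda>_ _. c) \<in> graphs" using assms by (intro mkgraph_in_graphs) (auto simp: lessThan_empty_iff)
qed (auto simp: monochromatic_def adj_mkgraph)

lemma mono_upto_nonempty:
  assumes "1 \<le> s"
  shows "mono_upto c s \<noteq> {}"
proof -
  obtain G where "G \<in> graphs" "monochromatic c G" "card (verts G) = 1"
    using ex_monochromatic[of 1 c] by blast
  then have "G \<in> mono_upto c s" using assms by (simp add: mono_upto_def one_enat_def)
  then show ?thesis by blast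
qed

text \<open>One vertex spans no pair. A factor of bound 1 can therefore be recoloured to match the
  other factor.\<close>

lemma mono_upto_1: "mono_upto c 1 = mono_upto d 1"
proof -
  have "monochromatic a G" if "G \<in> graphs" "card (verts G) \<le> 1" for a G
    using that finite_verts by (auto simp: monochromatic_def card_le_Suc0_iff_eq)
  then show ?thesis by (auto simp: mono_upto_def one_enat_def)
qed

lemma monochromatic_embeds:
  assumes "G \<in> graphs" "H \<in> graphs" "monochromatic c G" "monochromatic c H"
    "card (verts G) \<le> card (verts H)"
  shows "\<exists>f. embeds f G H"
proof -
  obtain f where "f ` verts G \<subseteq> verts H" "inj_on f (verts G)"
    using card_le_inj[of "verts G" "verts H"] assms finite_verts by blast
  moreover from this have "f u \<noteq> f v" "f u \<in> verts H" "f v \<in> verts H"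
    if "u \<in> verts G" "v \<in> verts G" "u \<noteq> v" for u v
    using that by (auto simp: inj_on_def)
  ultimately have "embeds f G H"
    using assms(3,4) unfolding embeds_def monochromatic_def by metis
  then show ?thesis by blast
qed

lemma monochromatic_same_card_mem:
  assumes "graph_property Q" "H \<in> Q" "G \<in> graphs" "monochromatic c G" "monochromatic c H"
    "card (verts G) = card (verts H)"
  shows "G \<in> Q"
proof (rule property_iso[OF assms(1,2,3)])
  have H: "H \<in> graphs" using assms property_in_graphs by blast
  then obtain f where f: "bij_betw f (verts H) (verts G)"
    using finite_same_card_bij[of "verts H" "verts G"] assms finite_verts by metis
  show "graph_iso H G"
  proof (rule graph_isoI[OF H assms(3) f])
    fix u v assume "u \<in> verts H" "v \<in> verts H" "u \<noteq> v"
    moreover from this have "f u \<noteq> f v" "f u \<in> verts G" "f v \<in> verts G"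
      using f by (auto simp: bij_betw_def inj_on_def)
    ultimately show "adj G (f u) (f v) = adj H u v"
      using assms(4,5) monochromaticD by blast
  qed
qed

text \<open>The cross pairs of a join are free, so a pair of colour \<open>\<not> c\<close> can be
  produced. Hence no \<open>mono_upto c s\<close> is a product of two nonempty properties.\<close>

lemma gprod_not_monochromatic:
  assumes "graph_property Q" "graph_property R" "Q \<noteq> {}" "R \<noteq> {}"
  obtains G where "G \<in> Q \<odot> R" "\<not> monochromatic c G"
proof -
  obtain X Y where XY: "X \<in> Q" "Y \<in> R" using assms by blast
  obtain G f g where G: "G \<in> Q \<odot> R" "embeds f X G" "embeds g Y G" "f ` verts X \<inter> g ` verts Y = {}"
    "\<And>x y. x \<in> verts X \<Longrightarrow> y \<in> verts Y \<Longrightarrow> adj G (f x) (g y) = (\<not> c)"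
    using join_in_gprod[OF assms(1,2) XY, where C = "\<lambda>_ _. \<not> c"] by metis
  obtain x y where xy: "x \<in> verts X" "y \<in> verts Y"
    using XY assms property_in_graphs verts_nonempty by (metis all_not_in_conv)
  have "f x \<in> verts G" "g y \<in> verts G" "f x \<noteq> g y"
    using G xy by (auto simp: embeds_def)
  then have "\<not> monochromatic c G" using G(5)[OF xy] monochromaticD by metis
  with G(1) show ?thesis using that by blast
qed

lemma gprod_neq_mono_upto:
  assumes "graph_property Q" "graph_property R" "Q \<noteq> {}" "R \<noteq> {}"
  shows "Q \<odot> R \<noteq> mono_upto c s"
  using gprod_not_monochromatic[OF assms, of c] mono_uptoD(2) by metis

lemma irreducible_mono_upto: "irreducible_property (mono_upto c s)"
  using reducibleE[OF graph_property_mono_upto[of c s]] gprod_neq_mono_upto by metis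

section \<open>Classification of the cancellable factors\<close>

lemma hereditary_monochromatic_eq_mono_upto:
  assumes Q: "graph_property Q" "induced_hereditary Q" "Q \<noteq> {}"
    and mono: "\<And>X. X \<in> Q \<Longrightarrow> monochromatic c X"
  obtains s where "1 \<le> s" "Q = mono_upto c s"
proof
  \<comment> \<open>This is infinite exactly when the orders in \<open>Q\<close> are unbounded. It
    is then not attained, so the proof below looks for a member at least as large as
    \<open>G\<close>.\<close>
  define s where "s = (SUP G\<in>Q. enat (card (verts G)))"
  have upper: "enat (card (verts G)) \<le> s" if "G \<in> Q" for G
    unfolding s_def using that by (rule SUP_upper)
  obtain X where X: "X \<in> Q" using Q by blast
  have "1 \<le> enat (card (verts X))"
    using card_verts_pos[of X] X Q property_in_graphs by (auto simp: one_enat_def)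
  with upper[OF X] show "1 \<le> s" by (rule order_trans[rotated])
  show "Q = mono_upto c s"
  proof
    show "Q \<subseteq> mono_upto c s"
      using mono upper Q(1) property_in_graphs by (auto simp: mono_upto_def)
    show "mono_upto c s \<subseteq> Q"
    proof
      fix G assume G: "G \<in> mono_upto c s"
      then have gG: "G \<in> graphs" by (rule mono_uptoD)
      have "\<exists>H\<in>Q. card (verts G) \<le> card (verts H)"
      proof (rule ccontr)
        assume "\<not> ?thesis"
        then have "s \<le> enat (card (verts G) - 1)"
          unfolding s_def by (intro SUP_least) force
        then have "enat (card (verts G)) \<le> enat (card (verts G) - 1)"
          using mono_uptoD(3)[OF G] by (rule order_trans[rotated])
        then show False using card_verts_pos[OF gG] by simp
      qed
      then obtain H where H: "H \<in> Q" "card (verts G) \<le> card (verts H)" by blast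
      then have "\<exists>f. embeds f G H"
        using monochromatic_embeds gG mono_uptoD(2)[OF G] mono property_in_graphs Q(1) by blast
      then have "G \<in> hclose Q" using H gG by (auto simp: hclose_def)
      then show "G \<in> Q" using hclose_eq Q by simp
    qed
  qed
qed

text \<open>If both colours occur in members of \<open>Q\<close>, heredity puts every two-vertex
  graph into \<open>Q\<close>. The critical graph contains a pair that is not in \<open>Q\<close>, a
  contradiction.\<close>

lemma cancellable_imp_mono_upto:
  assumes Q: "graph_property Q" "induced_hereditary Q" "Q \<noteq> {}"
    and R: "graph_property R" "induced_hereditary R" "R \<noteq> {}" and cancel: "cancellable Q R"
  obtains c s where "1 \<le> s" "Q = mono_upto c s"
proof (cases "\<exists>c. \<forall>X\<in>Q. monochromatic c X")
  case True
  then show ?thesis using that hereditary_monochromatic_eq_mono_upto[OF Q] by metis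
next
  case False
  \<comment> \<open>Not all members have colour \<open>\<not> c\<close>, which yields a pair of
    colour \<open>c\<close>.\<close>
  have pair: "\<exists>X\<in>Q. \<exists>x\<in>verts X. \<exists>y\<in>verts X. x \<noteq> y \<and> adj X x y = c" for c
    using False unfolding monochromatic_def by (metis (full_types))
  obtain X x y where X: "X \<in> Q" "x \<in> verts X" "y \<in> verts X" "x \<noteq> y" using pair by blast
  have "card (verts X) \<noteq> 1" using X by (auto simp: card_1_singleton_iff)
  then obtain G v where G: "G \<in> graphs" "v \<in> verts G" "verts G \<noteq> {v}"
    "\<And>u. u \<in> verts G \<Longrightarrow> u \<noteq> v \<Longrightarrow> induced G {u, v} \<notin> Q"
    using cancellable_critical_graph[OF Q(1,2) R cancel X(1)] by metis
  then obtain u where u: "u \<in> verts G" "u \<noteq> v" by blast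
  obtain Y a b where Y: "Y \<in> Q" "a \<in> verts Y" "b \<in> verts Y" "a \<noteq> b" "adj Y a b = adj G u v"
    using pair by blast
  have "embeds (\<lambda>w. if w = u then a else b) (induced G {u, v}) Y"
    using Y u by (auto simp: embeds_def inj_on_def adj_induced adj_commute[of Y b a] adj_commute[of G v u])
  then have "induced G {u, v} \<in> hclose Q"
    using Y G u by (auto simp: hclose_def intro: induced_in_graphs)
  then show ?thesis using G(4)[OF u] hclose_eq Q by simp
qed

text \<open>A critical graph would consist of a vertex \<open>v\<close> and a homogeneous rest of
  colour \<open>\<not> c\<close>. Some pair \<open>{u, v}\<close> then has colour \<open>c\<close>,
  and \<open>2 \<le> r\<close> puts it into the first factor, which criticality forbids.\<close>

lemma not_cancellable_opposite:
  assumes "2 \<le> r"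
  shows "\<not> cancellable (mono_upto c r) (mono_upto (\<not> c) \<infinity>)"
proof
  assume cancel: "cancellable (mono_upto c r) (mono_upto (\<not> c) \<infinity>)"
  obtain X where "X \<in> graphs" "monochromatic c X" "card (verts X) = 2"
    using ex_monochromatic[of 2 c] one_le_numeral by blast
  then have "X \<in> mono_upto c r" "card (verts X) \<noteq> 1"
    using assms by (auto simp: mono_upto_def numeral_eq_enat)
  then obtain G v where G: "G \<in> graphs" "v \<in> verts G" "induced G (verts G - {v}) \<in> mono_upto (\<not> c) \<infinity>"
    "G \<notin> mono_upto (\<not> c) \<infinity>"
    "\<And>u. u \<in> verts G \<Longrightarrow> u \<noteq> v \<Longrightarrow> induced G {u, v} \<notin> mono_upto c r"
    using cancellable_critical_graph[OF graph_property_mono_upto induced_hereditary_mono_upto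
        graph_property_mono_upto induced_hereditary_mono_upto mono_upto_nonempty cancel] by (metis enat_ord_code(3))
  \<comment> \<open>The bound is infinite, so \<open>G\<close> can fail to lie in
    \<open>mono_upto (\<not> c) \<infinity>\<close> only through a pair of colour
    \<open>c\<close>.\<close>
  obtain x y where xy: "x \<in> verts G" "y \<in> verts G" "x \<noteq> y" "adj G x y = c"
    using G(1,4) by (auto simp: mono_upto_def monochromatic_def)
  have "adj G a b = (\<not> c)" if "a \<in> verts G - {v}" "b \<in> verts G - {v}" "a \<noteq> b" for a b
    using mono_uptoD(2)[OF G(3)] that unfolding monochromatic_induced_iff by blast
  then have "x = v \<or> y = v" using xy by blast
  then obtain u where u: "u \<in> verts G" "u \<noteq> v" "adj G u v = c"
    using xy adj_commute[of G x y] by auto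
  have "monochromatic c (induced G {u, v})"
    using u adj_commute[of G u v] by (auto simp: monochromatic_induced_iff)
  then have "induced G {u, v} \<in> mono_upto c r"
    using G(1,2) u assms induced_in_graphs[of G "{u, v}"]
    by (simp add: mono_upto_def numeral_eq_enat numeral_2_eq_2)
  then show False using G(5)[OF u(1,2)] by blast
qed

text \<open>\<open>graphs\<close> absorbs the irreducible property \<open>mono_upto True 1\<close>,
  so any factorisation of it could be lengthened.\<close>

lemma not_unique_factorisation_graphs: "\<not> unique_factorisation graphs"
proof
  assume uniq: "unique_factorisation graphs"
  then obtain Ps where Ps: "factorisation Ps graphs"
    by (auto simp: unique_factorisation_def)
  have gp: "graph_property graphs" by (simp add: graph_property_def)
  have ne: "mono_upto True 1 \<noteq> {}" by (rule mono_upto_nonempty) simp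
  then have "graphs \<noteq> {}" by (auto simp: mono_upto_def)
  then have "factorisation (Ps @ [mono_upto True 1]) (graphs \<odot> mono_upto True 1)"
    using factorisation_append[OF Ps factorisation_singleton[OF irreducible_mono_upto]] ne by simp
  moreover have "graphs \<odot> mono_upto True 1 = graphs"
    using gprod_superset1[OF gp] gprod_in_graphs by blast
  ultimately have "mset (Ps @ [mono_upto True 1]) = mset Ps"
    using Ps uniq by (metis unique_factorisation_def)
  then show False by simp
qed

text \<open>In any splitting into two nonempty factors each factor cancels against the other.
  Heredity is derived for both first, since the critical graph relies on heredity of both; then both
  are homogeneous.\<close>

lemma unique_factorisation_imp:
  assumes P: "graph_property P" "induced_hereditary P"
    and uniq: "unique_factorisation P" and red: "\<not> irreducible_property P"
  obtains c d r s where "1 \<le> r" "1 \<le> s" "P = mono_upto c r \<odot> mono_upto d s"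
    "c = d \<or> r \<noteq> \<infinity> \<and> s \<noteq> \<infinity>"
proof -
  have all: "P \<noteq> graphs" using uniq not_unique_factorisation_graphs by auto
  obtain Q R where Q: "graph_property Q" "Q \<noteq> {}" and R: "graph_property R" "R \<noteq> {}" and eq: "P = Q \<odot> R"
    using reducibleE[OF P(1) red] by metis
  have eq': "P = R \<odot> Q" using eq gprod_commute by simp
  have cQ: "cancellable Q R" and cR: "cancellable R Q"
    using unique_factorisation_cancellable[OF P all uniq] Q R eq eq' by blast+
  have hQ: "induced_hereditary Q" and hR: "induced_hereditary R"
    using cancellable_imp_hereditary[OF P Q R(1) eq cQ] cancellable_imp_hereditary[OF P R Q(1) eq' cR]
    by auto
  obtain c r where r: "1 \<le> r" "Q = mono_upto c r"
    using cancellable_imp_mono_upto[OF Q(1) hQ Q(2) R(1) hR R(2) cQ] by metis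
  obtain d s where s: "1 \<le> s" "R = mono_upto d s"
    using cancellable_imp_mono_upto[OF R(1) hR R(2) Q(1) hQ Q(2) cR] by metis
  have one: "a = 1 \<or> 2 \<le> a" if "1 \<le> a" for a :: enat
    using that by (cases a) (auto simp: one_enat_def numeral_eq_enat)
  consider "c = d" | "d = (\<not> c)" "r = \<infinity>" | "d = (\<not> c)" "s = \<infinity>" | "r \<noteq> \<infinity>" "s \<noteq> \<infinity>" by blast
  then show ?thesis
  proof cases
    \<comment> \<open>An unbounded factor of the opposite colour forces the other bound down to 1,
      and a factor of bound 1 may be recoloured, which leads back to equal colours.\<close>
    case 2
    then have "s = 1"
      using one[OF s(1)] not_cancellable_opposite[of s d] cR r s by auto
    then show ?thesis
      using that[of r 1 c c] eq r s mono_upto_1 by metis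
  next
    case 3
    then have "r = 1"
      using one[OF r(1)] not_cancellable_opposite[of r c] cQ r s by auto
    then show ?thesis
      using that[of 1 s d d] eq r s mono_upto_1 by metis
  qed (use that[of r s c d] eq r s in blast)+
qed

text \<open>In a longer factorisation, irreducibility makes the first factor or the product of the
  rest equal to \<open>P\<close>. Then \<open>P\<close> absorbs a nonempty property, so
  \<open>P = graphs\<close>; but \<open>graphs\<close> is reducible.\<close>

lemma irreducible_imp_unique_factorisation:
  assumes P: "graph_property P" "induced_hereditary P" and irr: "irreducible_property P"
  shows "unique_factorisation P"
proof -
  have all: "P \<noteq> graphs"
  proof
    assume P_all: "P = graphs"
    \<comment> \<open>Deleting the one-vertex graphs from \<open>graphs\<close> and restoring them
      through the second factor splits \<open>graphs\<close> into two other properties.\<close>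
    let ?Q = "{G \<in> graphs. card (verts G) \<noteq> 1}" and ?R = "mono_upto True 1"
    have gp: "graph_property ?Q"
      using graph_property_card_filter[of graphs "\<lambda>n. n \<noteq> 1"] P P_all by simp
    obtain X where X: "X \<in> graphs" "card (verts X) = 1" using ex_monochromatic[of 1] by blast
    obtain Y where Y: "Y \<in> graphs" "card (verts Y) = 2" using ex_monochromatic[of 2] one_le_numeral by blast
    have "X \<in> ?Q \<odot> ?R" if "X \<in> graphs" for X
    proof (cases "card (verts X) = 1")
      case True
      then have "monochromatic True X" by (auto simp: monochromatic_def card_1_singleton_iff)
      then have "X \<in> ?R" using True that by (simp add: mono_upto_def one_enat_def)
      then show ?thesis using gprod_superset2[OF graph_property_mono_upto] by blast
    next
      case False
      then have "X \<in> ?Q" using that by simp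
      then show ?thesis using gprod_superset1[OF gp] by blast
    qed
    then have "P = ?Q \<odot> ?R" using P_all gprod_in_graphs by blast
    moreover have "X \<notin> ?Q" using X by simp
    then have "?Q \<noteq> P" using X P_all by blast
    moreover have "Y \<notin> ?R" using Y by (simp add: mono_upto_def one_enat_def)
    then have "?R \<noteq> P" using Y P_all by blast
    ultimately have "reducible_property P"
      using gp graph_property_mono_upto unfolding reducible_property_def by blast
    then show False using irr by (simp add: irreducible_property_def)
  qed
  have "Qs = [P]" if "factorisation Qs P" for Qs
    using that
  proof (cases rule: factorisation_cases)
    case (2 Q Rs)
    then have "Q = P \<or> gprods Rs = P"
      using irr unfolding irreducible_property_def reducible_property_def by blast
    then have "P = graphs"
      using absorbing_imp_all[OF P, of Q] absorbing_imp_all[OF P, of "gprods Rs"] 2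
        gprod_commute by metis
    with all show ?thesis by simp
  qed
  then show ?thesis
    using factorisation_singleton[OF irr] unfolding unique_factorisation_def by metis
qed

section \<open>Uniqueness of the two-colour products\<close>

text \<open>With \<open>p = q\<close> and \<open>x = \<not> p\<close> these are complete bipartite
  graphs and their complements; with \<open>q = \<not> p\<close> they are split graphs with
  uniformly coloured cross pairs.\<close>

definition bicoloured :: "nat \<Rightarrow> nat \<Rightarrow> bool \<Rightarrow> bool \<Rightarrow> bool \<Rightarrow> graph" where
  "bicoloured a b p q x =
     mkgraph {..<a + b} (\<lambda>u v. if u < a \<and> v < a then p else if a \<le> u \<and> a \<le> v then q else x)"

lemma verts_bicoloured: "verts (bicoloured a b p q x) = {..<a} \<union> {a..<a + b}"
  by (auto simp: bicoloured_def)

lemma bicoloured_in_graphs: "1 \<le> a \<Longrightarrow> bicoloured a b p q x \<in> graphs"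
  unfolding bicoloured_def by (intro mkgraph_in_graphs) (auto simp: lessThan_empty_iff)

lemma adj_bicoloured:
  assumes "u < a + b" "v < a + b" "u \<noteq> v"
  shows "adj (bicoloured a b p q x) u v =
    (if u < a \<and> v < a then p else if a \<le> u \<and> a \<le> v then q else x)"
  unfolding bicoloured_def using assms by (subst adj_mkgraph) auto

lemma bicoloured_parts:
  assumes "1 \<le> a" "1 \<le> b"
  shows "induced (bicoloured a b p q x) {..<a} \<in> graphs"
    "monochromatic p (induced (bicoloured a b p q x) {..<a})"
    "induced (bicoloured a b p q x) {a..<a + b} \<in> graphs"
    "monochromatic q (induced (bicoloured a b p q x) {a..<a + b})"
  using assms
  by (auto simp: monochromatic_induced_iff adj_bicoloured verts_bicoloured lessThan_empty_iff
      intro!: induced_in_graphs bicoloured_in_graphs)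

lemma bicoloured_in_gprod:
  assumes "1 \<le> a" "1 \<le> b" "enat a \<le> r" "enat b \<le> s"
  shows "bicoloured a b p q x \<in> mono_upto p r \<odot> mono_upto q s"
proof (rule gprodI[of _ "{..<a}" "{a..<a + b}"])
  show "{..<a} = {} \<or> induced (bicoloured a b p q x) {..<a} \<in> mono_upto p r"
    "{a..<a + b} = {} \<or> induced (bicoloured a b p q x) {a..<a + b} \<in> mono_upto q s"
    using bicoloured_parts[OF assms(1,2), where p = p and q = q and x = x] assms(3,4) by (simp_all add: mono_upto_def)
qed (use assms(1) in \<open>auto simp: verts_bicoloured bicoloured_in_graphs\<close>)

text \<open>Factors may fail to be hereditary, so a bound on the orders says too little; a property
  of one fixed colour is determined by the whole set of orders.\<close>

definition orders :: "graph set \<Rightarrow> nat set" where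
  "orders Q = (\<lambda>G. card (verts G)) ` Q"

lemma monochromatic_mem_iff:
  assumes "graph_property Q" "\<And>X. X \<in> Q \<Longrightarrow> monochromatic c X" "G \<in> graphs" "monochromatic c G"
  shows "G \<in> Q \<longleftrightarrow> card (verts G) \<in> orders Q"
proof
  assume "card (verts G) \<in> orders Q"
  then obtain H where "H \<in> Q" "card (verts G) = card (verts H)" by (auto simp: orders_def)
  then show "G \<in> Q" using assms monochromatic_same_card_mem by blast
qed (simp add: orders_def)

lemma orders_mono_upto: "orders (mono_upto c s) = {n. 1 \<le> n \<and> enat n \<le> s}"
proof (intro set_eqI iffI)
  fix n assume "n \<in> {n. 1 \<le> n \<and> enat n \<le> s}"
  moreover from this obtain G where "G \<in> graphs" "monochromatic c G" "card (verts G) = n"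
    using ex_monochromatic[of n c] by blast
  ultimately show "n \<in> orders (mono_upto c s)"
    unfolding orders_def by (intro image_eqI[of _ _ G]) (auto simp: mono_upto_def)
qed (auto simp: orders_def mono_upto_def card_verts_pos dest: card_verts_pos)

lemma eq_mono_upto_if_orders_eq:
  assumes "graph_property Q" "\<And>X. X \<in> Q \<Longrightarrow> monochromatic c X"
    "orders Q = orders (mono_upto c s)"
  shows "Q = mono_upto c s"
proof (rule set_eqI)
  fix G
  have "G \<in> Q \<longleftrightarrow> card (verts G) \<in> orders Q"
    "G \<in> mono_upto c s \<longleftrightarrow> card (verts G) \<in> orders (mono_upto c s)"
    if "G \<in> graphs" "monochromatic c G"
    using that monochromatic_mem_iff assms(1,2) graph_property_mono_upto mono_uptoD(2) by metis+
  then show "G \<in> Q \<longleftrightarrow> G \<in> mono_upto c s"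
    using assms property_in_graphs mono_uptoD(1,2) by metis
qed

text \<open>The two sides are the only maximal \<open>c\<close>-coloured vertex sets of this graph, so a splitting
  into two \<open>c\<close>-coloured parts has to be the given one.\<close>

lemma bicoloured_in_gprod_iff:
  assumes Q: "graph_property Q" "\<And>X. X \<in> Q \<Longrightarrow> monochromatic c X"
    and R: "graph_property R" "\<And>X. X \<in> R \<Longrightarrow> monochromatic c X" and ab: "1 \<le> a" "1 \<le> b"
  shows "bicoloured a b c c (\<not> c) \<in> Q \<odot> R \<longleftrightarrow>
    a \<in> orders Q \<and> b \<in> orders R \<or> a \<in> orders R \<and> b \<in> orders Q"
proof
  let ?G = "bicoloured a b c c (\<not> c)" and ?L = "{..<a}" and ?U = "{a..<a + b}"
  assume "?G \<in> Q \<odot> R"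
  then obtain A B where AB: "A \<union> B = verts ?G" "A \<inter> B = {}"
    "A = {} \<or> induced ?G A \<in> Q" "B = {} \<or> induced ?G B \<in> R"
    by (elim gprodE)
  have side: "C \<subseteq> ?L \<or> C \<subseteq> ?U"
    if "C \<subseteq> verts ?G" "C = {} \<or> monochromatic c (induced ?G C)" for C
  proof (rule ccontr)
    assume "\<not> ?thesis"
    then obtain x y where xy: "x \<in> C" "y \<in> C" "x \<notin> ?L" "y \<notin> ?U" by blast
    moreover have "x \<in> ?U" "y \<in> ?L" using xy that(1) by (auto simp: verts_bicoloured)
    moreover have "adj ?G x y = c"
      using that(2) xy \<open>x \<in> ?U\<close> \<open>y \<in> ?L\<close> by (fastforce simp: monochromatic_induced_iff)
    ultimately show False by (auto simp: adj_bicoloured)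
  qed
  have "A \<subseteq> ?L \<or> A \<subseteq> ?U" "B \<subseteq> ?L \<or> B \<subseteq> ?U"
    using side[of A] side[of B] AB Q(2) R(2) by blast+
  moreover have "?L \<noteq> {}" "?U \<noteq> {}" "?L \<inter> ?U = {}" "A \<union> B = ?L \<union> ?U"
    using ab AB(1) by (auto simp: verts_bicoloured lessThan_empty_iff)
  ultimately have "A = ?L \<and> B = ?U \<or> A = ?U \<and> B = ?L" by blast
  moreover have "card C \<in> orders S" if "C \<noteq> {}" "C = {} \<or> induced ?G C \<in> S" for C S
    using that unfolding orders_def by (intro image_eqI[of _ _ "induced ?G C"]) auto
  ultimately show "a \<in> orders Q \<and> b \<in> orders R \<or> a \<in> orders R \<and> b \<in> orders Q"
    using AB(3,4) \<open>?L \<noteq> {}\<close> \<open>?U \<noteq> {}\<close> by (metis card_lessThan card_atLeastLessThan add_diff_cancel_left')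
next
  let ?G = "bicoloured a b c c (\<not> c)" and ?L = "{..<a}" and ?U = "{a..<a + b}"
  have mem: "induced ?G ?L \<in> S \<longleftrightarrow> a \<in> orders S" "induced ?G ?U \<in> S \<longleftrightarrow> b \<in> orders S"
    if "graph_property S" "\<And>X. X \<in> S \<Longrightarrow> monochromatic c X" for S
    using bicoloured_parts[OF ab, where p = c and q = c and x = "\<not> c"] monochromatic_mem_iff[OF that] by auto
  assume "a \<in> orders Q \<and> b \<in> orders R \<or> a \<in> orders R \<and> b \<in> orders Q"
  then have "induced ?G ?L \<in> Q \<and> induced ?G ?U \<in> R \<or> induced ?G ?U \<in> Q \<and> induced ?G ?L \<in> R"
    using mem[OF Q] mem[OF R] by blast
  moreover have "?L \<union> ?U = verts ?G" "?U \<union> ?L = verts ?G" "?L \<inter> ?U = {}" "?U \<inter> ?L = {}"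
    by (auto simp: verts_bicoloured)
  moreover have "?G \<in> graphs" using ab by (simp add: bicoloured_in_graphs)
  ultimately show "?G \<in> Q \<odot> R" using gprodI by metis
qed

text \<open>The slice at \<open>x\<close> recovers the union of the two sets and the diagonal
  recovers their intersection. For \<open>a\<close> and \<open>b\<close> in the symmetric
  difference, the pair \<open>(a, b)\<close> tells whether they lie on opposite sides of it.\<close>

lemma symmetric_rectangle_unique:
  assumes "\<And>a b. a \<in> A \<and> b \<in> B \<or> a \<in> B \<and> b \<in> A \<longleftrightarrow> a \<in> C \<and> b \<in> D \<or> a \<in> D \<and> b \<in> C"
    and "x \<in> C" "x \<in> D"
  shows "A = C \<and> B = D \<or> A = D \<and> B = C"
proof -
  have x: "x \<in> A" "x \<in> B" using assms(1)[of x x] assms(2,3) by auto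
  have union: "a \<in> A \<or> a \<in> B \<longleftrightarrow> a \<in> C \<or> a \<in> D" for a
    using assms(1)[of a x] assms(2,3) x by blast
  have inter: "a \<in> A \<and> a \<in> B \<longleftrightarrow> a \<in> C \<and> a \<in> D" for a
    using assms(1)[of a a] by blast
  show ?thesis
  proof (rule ccontr)
    assume "\<not> ?thesis"
    \<comment> \<open>\<open>y\<close> refutes the first matching and \<open>z\<close> the second.
      Both lie in exactly one set of each pair, \<open>y\<close> with sides swapped and
      \<open>z\<close> not, so the rectangles disagree at \<open>(y, z)\<close>.\<close>
    then obtain y z where "(y \<in> A) \<noteq> (y \<in> C) \<or> (y \<in> B) \<noteq> (y \<in> D)" "(z \<in> A) \<noteq> (z \<in> D) \<or> (z \<in> B) \<noteq> (z \<in> C)"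
      by blast
    then show False using assms(1)[of y z] union[of y] union[of z] inter[of y] inter[of z] by blast
  qed
qed

lemma gprod_mono_uptoE:
  assumes "G \<in> mono_upto c r \<odot> mono_upto d s"
  obtains A B where "A \<union> B = verts G" "A \<inter> B = {}" "finite A" "finite B"
    "\<And>u v. u \<in> A \<Longrightarrow> v \<in> A \<Longrightarrow> u \<noteq> v \<Longrightarrow> adj G u v = c" "enat (card A) \<le> r"
    "\<And>u v. u \<in> B \<Longrightarrow> v \<in> B \<Longrightarrow> u \<noteq> v \<Longrightarrow> adj G u v = d" "enat (card B) \<le> s"
proof -
  obtain A B where G: "G \<in> graphs" and AB: "A \<union> B = verts G" "A \<inter> B = {}"
    "A = {} \<or> induced G A \<in> mono_upto c r" "B = {} \<or> induced G B \<in> mono_upto d s"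
    using assms by (elim gprodE)
  have fin: "finite A" "finite B" using AB(1) finite_verts[OF G] by (metis finite_Un)+
  have part: "enat (card C) \<le> t \<and> (\<forall>u\<in>C. \<forall>v\<in>C. u \<noteq> v \<longrightarrow> adj G u v = e)"
    if "C = {} \<or> induced G C \<in> mono_upto e t" for C e t
    using that
  proof
    assume "C = {}"
    then show ?thesis by (simp add: zero_enat_def[symmetric])
  next
    assume "induced G C \<in> mono_upto e t"
    from mono_uptoD(2,3)[OF this] show ?thesis by (simp add: monochromatic_induced_iff)
  qed
  show ?thesis using that[OF AB(1,2) fin] part[OF AB(3)] part[OF AB(4)] by blast
qed

text \<open>A pair of colour \<open>\<not> c\<close> in \<open>X\<close> and a vertex from
  \<open>R\<close>, joined by cross pairs of colour \<open>\<not> c\<close>, form a triangle of that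
  colour. Two of its vertices fall into the same part, whose pairs have colour
  \<open>c\<close>.\<close>

lemma factors_same_colour_monochromatic:
  assumes Q: "graph_property Q" and R: "graph_property R" "R \<noteq> {}"
    and eq: "Q \<odot> R = mono_upto c r \<odot> mono_upto c s" and X: "X \<in> Q"
  shows "monochromatic c X"
  unfolding monochromatic_def
proof (intro ballI impI, rule ccontr)
  fix u v assume uv: "u \<in> verts X" "v \<in> verts X" "u \<noteq> v" "adj X u v \<noteq> c"
  obtain Y where Y: "Y \<in> R" using R by blast
  obtain y where y: "y \<in> verts Y" using Y R property_in_graphs verts_nonempty by blast
  obtain G f g where G: "G \<in> Q \<odot> R" "embeds f X G" "embeds g Y G" "f ` verts X \<inter> g ` verts Y = {}"
    "\<And>x y. x \<in> verts X \<Longrightarrow> y \<in> verts Y \<Longrightarrow> adj G (f x) (g y) = (\<not> c)"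
    using join_in_gprod[OF Q R(1) X Y, where C = "\<lambda>_ _. \<not> c"] by metis
  have ne: "f u \<noteq> f v" "f u \<noteq> g y" "f v \<noteq> g y"
    using G uv y by (auto simp: embeds_def inj_on_def)
  have ver: "f u \<in> verts G" "f v \<in> verts G" "g y \<in> verts G"
    using G uv y by (auto simp: embeds_def)
  have "adj G (f u) (f v) = adj X u v" using G(2) uv by (auto simp: embeds_def)
  then have ad: "adj G (f u) (f v) \<noteq> c" "adj G (f u) (g y) \<noteq> c" "adj G (f v) (g y) \<noteq> c"
    using G(5) uv y by auto
  obtain A B where AB: "A \<union> B = verts G"
    "\<And>x z. x \<in> A \<Longrightarrow> z \<in> A \<Longrightarrow> x \<noteq> z \<Longrightarrow> adj G x z = c"
    "\<And>x z. x \<in> B \<Longrightarrow> z \<in> B \<Longrightarrow> x \<noteq> z \<Longrightarrow> adj G x z = c"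
    using gprod_mono_uptoE[of G c r c s] G(1) unfolding eq by metis
  show False using AB ne ver ad by (metis UnE)
qed

text \<open>The \<open>bicoloured\<close> graphs translate the equation of products into one between
  symmetrised rectangles of orders; the order 1, common to both factors on the right, makes the
  sides unique.\<close>

lemma factors_same_colour:
  assumes Q: "graph_property Q" "Q \<noteq> {}" and R: "graph_property R" "R \<noteq> {}"
    and eq: "Q \<odot> R = mono_upto c r \<odot> mono_upto c s" and rs: "1 \<le> r" "1 \<le> s"
  shows "Q = mono_upto c r \<and> R = mono_upto c s \<or> Q = mono_upto c s \<and> R = mono_upto c r"
proof -
  have eq': "R \<odot> Q = mono_upto c r \<odot> mono_upto c s" using eq gprod_commute by simp
  have mQ: "monochromatic c X" if "X \<in> Q" for X
    using factors_same_colour_monochromatic[OF Q(1) R eq that] .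
  have mR: "monochromatic c X" if "X \<in> R" for X
    using factors_same_colour_monochromatic[OF R(1) Q eq' that] .
  let ?C = "orders (mono_upto c r)" and ?D = "orders (mono_upto c s)"
  have pos: "1 \<le> a" if "graph_property S" "a \<in> orders S" for a S
    using that card_verts_pos property_in_graphs unfolding orders_def by blast
  have "a \<in> orders Q \<and> b \<in> orders R \<or> a \<in> orders R \<and> b \<in> orders Q \<longleftrightarrow>
      a \<in> ?C \<and> b \<in> ?D \<or> a \<in> ?D \<and> b \<in> ?C" for a b
  proof (cases "1 \<le> a \<and> 1 \<le> b")
    case True
    then show ?thesis
      using bicoloured_in_gprod_iff[OF Q(1) mQ R(1) mR, where a = a and b = b]
        bicoloured_in_gprod_iff[OF graph_property_mono_upto[of c r] mono_uptoD(2)[of _ c r]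
          graph_property_mono_upto[of c s] mono_uptoD(2)[of _ c s], where a = a and b = b] eq by simp
  next
    case False
    then show ?thesis using pos Q(1) R(1) graph_property_mono_upto by blast
  qed
  moreover have "1 \<in> ?C" "1 \<in> ?D" using rs by (auto simp: orders_mono_upto one_enat_def)
  ultimately have "orders Q = ?C \<and> orders R = ?D \<or> orders Q = ?D \<and> orders R = ?C"
    using symmetric_rectangle_unique[of "orders Q" "orders R" ?C ?D 1] by blast
  then show ?thesis
    using eq_mono_upto_if_orders_eq[OF Q(1) mQ] eq_mono_upto_if_orders_eq[OF R(1) mR] by blast
qed

section \<open>Products of two opposite colours\<close>

text \<open>These are the patterns \<open>2K\<^sub>2\<close> and \<open>C\<^sub>4\<close>, which no split graph contains.\<close>

lemma split_graph_no_alternating_square: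
  assumes "G \<in> mono_upto c r \<odot> mono_upto (\<not> c) s" "{p, q, x, y} \<subseteq> verts G"
    "distinct [p, q, x, y]" "adj G p q = e" "adj G x y = e"
    "adj G p x = (\<not> e)" "adj G p y = (\<not> e)" "adj G q x = (\<not> e)" "adj G q y = (\<not> e)"
  shows False
proof -
  obtain A B where AB: "A \<union> B = verts G"
    "\<And>u v. u \<in> A \<Longrightarrow> v \<in> A \<Longrightarrow> u \<noteq> v \<Longrightarrow> adj G u v = c"
    "\<And>u v. u \<in> B \<Longrightarrow> v \<in> B \<Longrightarrow> u \<noteq> v \<Longrightarrow> adj G u v = (\<not> c)"
    using gprod_mono_uptoE[OF assms(1)] by metis
  \<comment> \<open>No three of the four vertices span a single colour, so each part takes two of
    them. But complementary pairs have the same colour, while the two parts have different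
    ones.\<close>
  have "p \<in> A \<or> p \<in> B" "q \<in> A \<or> q \<in> B" "x \<in> A \<or> x \<in> B" "y \<in> A \<or> y \<in> B"
    using AB(1) assms(2) by auto
  then show False
    using AB(2)[of p q] AB(2)[of x y] AB(2)[of p x] AB(2)[of p y] AB(2)[of q x] AB(2)[of q y]
      AB(3)[of p q] AB(3)[of x y] AB(3)[of p x] AB(3)[of p y] AB(3)[of q x] AB(3)[of q y]
      assms(3-) by (cases c; cases e) auto
qed

text \<open>Three vertices of \<open>X\<close> spanning both colours extend by a vertex of the other
  factor, with suitable cross pairs, to the forbidden square.\<close>

lemma factors_opposite_homogeneous:
  assumes Q: "graph_property Q" and R: "graph_property R" "R \<noteq> {}"
    and eq: "Q \<odot> R = mono_upto c r \<odot> mono_upto (\<not> c) s" and X: "X \<in> Q"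
  shows "\<exists>d. monochromatic d X"
proof (rule ccontr)
  assume "\<nexists>d. monochromatic d X"
  then have "\<not> monochromatic True X" "\<not> monochromatic False X" by auto
  then obtain a b a' b' where "a \<in> verts X" "b \<in> verts X" "a \<noteq> b" "adj X a b"
    "a' \<in> verts X" "b' \<in> verts X" "a' \<noteq> b'" "\<not> adj X a' b'"
    unfolding monochromatic_def by auto
  \<comment> \<open>Any two pairs are linked by a chain of pairs in which neighbours share a vertex,
    so both colours meet at some vertex \<open>x\<close>.\<close>
  then obtain x y z where xyz: "x \<in> verts X" "y \<in> verts X" "z \<in> verts X" "x \<noteq> y" "x \<noteq> z"
    "adj X x y \<noteq> adj X x z"
    using adj_commute by metis
  \<comment> \<open>one pair of the triple has the minority colour; \<open>w\<close> is the vertex outside it\<close>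
  then obtain u v w e where uvw: "u \<in> verts X" "v \<in> verts X" "w \<in> verts X" "distinct [u, v, w]"
    "adj X u v = e" "adj X u w = (\<not> e)" "adj X v w = (\<not> e)"
  proof (cases "adj X y z = adj X x y")
    case True
    then show ?thesis
      using that[of x z y "adj X x z"] xyz adj_commute[of X y z] by auto
  next
    case False
    then show ?thesis
      using that[of x y z "adj X x y"] xyz by auto
  qed
  obtain Y where Y: "Y \<in> R" using R by blast
  obtain t where t: "t \<in> verts Y" using Y R property_in_graphs verts_nonempty by blast
  \<comment> \<open>The new vertex and \<open>w\<close> form the second pair of colour
    \<open>e\<close>; the pairs between it and \<open>u\<close>, \<open>v\<close> get colour
    \<open>\<not> e\<close>.\<close>
  obtain G f g where G: "G \<in> Q \<odot> R" "embeds f X G" "embeds g Y G" "f ` verts X \<inter> g ` verts Y = {}"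
    "\<And>a b. a \<in> verts X \<Longrightarrow> b \<in> verts Y \<Longrightarrow> adj G (f a) (g b) = (if a = w then e else \<not> e)"
    using join_in_gprod[OF Q R(1) X Y, where C = "\<lambda>a _. if a = w then e else \<not> e"] by metis
  have adjX: "adj G (f a) (f b) = adj X a b" "f a \<noteq> f b"
    if "a \<in> verts X" "b \<in> verts X" "a \<noteq> b" for a b
    using G(2) that by (auto simp: embeds_def inj_on_def)
  have ne: "f a \<noteq> g t" "f a \<in> verts G" if "a \<in> verts X" for a
    using G(2,4) t that by (auto simp: embeds_def)
  have "g t \<in> verts G" using G(3) t by (auto simp: embeds_def)
  then show False
    using split_graph_no_alternating_square[of G c r s "f u" "f v" "f w" "g t" e]
      G(1,5) eq uvw t adjX ne by auto
qed

text \<open>Two pairs of equal colour, joined by cross pairs of the other colour, form the forbidden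
  square.\<close>

lemma factors_opposite_different_colours:
  assumes Q: "graph_property Q" and R: "graph_property R"
    and eq: "Q \<odot> R = mono_upto c r \<odot> mono_upto (\<not> c) s"
    and X: "X \<in> Q" "2 \<le> card (verts X)" "monochromatic d X"
    and Y: "Y \<in> R" "2 \<le> card (verts Y)" "monochromatic e Y"
  shows "d \<noteq> e"
proof
  assume "d = e"
  have two: "\<exists>x\<in>A. \<exists>y\<in>A. x \<noteq> y" if "2 \<le> card A" for A :: "nat set"
    using that card_le_Suc0_iff_eq[of A] by (cases "finite A") fastforce+
  obtain x x' where x: "x \<in> verts X" "x' \<in> verts X" "x \<noteq> x'" using two X(2) by blast
  obtain y y' where y: "y \<in> verts Y" "y' \<in> verts Y" "y \<noteq> y'" using two Y(2) by blast
  obtain G f g where G: "G \<in> Q \<odot> R" "embeds f X G" "embeds g Y G" "f ` verts X \<inter> g ` verts Y = {}"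
    "\<And>a b. a \<in> verts X \<Longrightarrow> b \<in> verts Y \<Longrightarrow> adj G (f a) (g b) = (\<not> d)"
    using join_in_gprod[OF Q R X(1) Y(1), where C = "\<lambda>_ _. \<not> d"] by metis
  have 1: "f x \<noteq> f x'" "adj G (f x) (f x') = d" "g y \<noteq> g y'" "adj G (g y) (g y') = d"
    using G(2,3) x y X(3) Y(3) \<open>d = e\<close> by (auto simp: embeds_def inj_on_def monochromatic_def)
  have 2: "{f x, f x', g y, g y'} \<subseteq> verts G" using G(2,3) x y by (auto simp: embeds_def)
  have 3: "f a \<noteq> g b" if "a \<in> verts X" "b \<in> verts Y" for a b using G(4) that by blast
  show False
    using split_graph_no_alternating_square[of G c r s "f x" "f x'" "g y" "g y'" d] G(1,5) eq 1 2 3 x y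
    by auto
qed

text \<open>Adding a vertex of the other factor with cross pairs of colour \<open>c\<close> keeps
  the colour. The part of colour \<open>\<not> c\<close> takes at most one of these
  \<open>card (verts X) + 1\<close> vertices and the other part at most \<open>r\<close>.\<close>

lemma factors_opposite_card_le:
  assumes Q: "graph_property Q" and R: "graph_property R" "R \<noteq> {}"
    and eq: "Q \<odot> R = mono_upto c (enat r) \<odot> mono_upto (\<not> c) s"
    and X: "X \<in> Q" "monochromatic c X"
  shows "card (verts X) \<le> r"
proof -
  obtain Y where Y: "Y \<in> R" using R by blast
  obtain t where t: "t \<in> verts Y" using Y R property_in_graphs verts_nonempty by blast
  obtain G f g where G: "G \<in> Q \<odot> R" "embeds f X G" "embeds g Y G" "f ` verts X \<inter> g ` verts Y = {}"
    "\<And>a b. a \<in> verts X \<Longrightarrow> b \<in> verts Y \<Longrightarrow> adj G (f a) (g b) = c"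
    using join_in_gprod[OF Q R(1) X(1) Y, where C = "\<lambda>_ _. c"] by metis
  obtain A B where AB: "A \<union> B = verts G" "A \<inter> B = {}" "finite A" "finite B" "enat (card A) \<le> enat r"
    "\<And>u v. u \<in> B \<Longrightarrow> v \<in> B \<Longrightarrow> u \<noteq> v \<Longrightarrow> adj G u v = (\<not> c)"
    using gprod_mono_uptoE[of G c "enat r" "\<not> c" s] G(1) eq by metis
  let ?Z = "insert (g t) (f ` verts X)"
  have finX: "finite (verts X)" using X(1) Q property_in_graphs finite_verts by blast
  have "card (f ` verts X) = card (verts X)"
    using G(2) by (intro card_image) (simp add: embeds_def)
  then have cardZ: "card ?Z = Suc (card (verts X))"
    using G(4) t finX by (subst card_insert_disjoint) auto
  have Z: "adj G u v = c" if "u \<in> ?Z" "v \<in> ?Z" "u \<noteq> v" for u v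
  proof -
    have ff: "adj G (f a) (f b) = c" if "a \<in> verts X" "b \<in> verts X" "f a \<noteq> f b" for a b
      using G(2) X(2) that by (auto simp: embeds_def monochromatic_def)
    show ?thesis
      using that ff G(5)[OF _ t] adj_commute[of G "g t"] by auto
  qed
  have "?Z \<subseteq> A \<union> B" using AB(1) G(2,3) t by (auto simp: embeds_def)
  then have "?Z = (?Z \<inter> A) \<union> (?Z \<inter> B)" by blast
  then have "card ?Z \<le> card (?Z \<inter> A) + card (?Z \<inter> B)" using card_Un_le by metis
  moreover have "card (?Z \<inter> A) \<le> card A" using AB by (intro card_mono) auto
  moreover have "card (?Z \<inter> B) \<le> Suc 0"
  proof -
    have "u = v" if "u \<in> ?Z \<inter> B" "v \<in> ?Z \<inter> B" for u v
      using Z[of u v] AB(6)[of u v] that by blast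
    moreover have "finite (?Z \<inter> B)" using AB by simp
    ultimately show ?thesis using card_le_Suc0_iff_eq by blast
  qed
  ultimately show ?thesis using cardZ AB(5) by simp
qed

text \<open>Orders in \<open>Q\<close> and \<open>R\<close> are at most \<open>r\<close> and
  \<open>s\<close>. To realise an order \<open>a\<close> in \<open>Q\<close>, a split graph on
  \<open>a + s\<close> vertices is taken in which no set of colour \<open>c\<close> exceeds
  \<open>a\<close> vertices; the part in \<open>Q\<close> then has exactly \<open>a\<close>.\<close>

lemma factors_opposite_oriented:
  assumes Q: "graph_property Q" "\<And>X. X \<in> Q \<Longrightarrow> monochromatic c X" "Q \<noteq> {}"
    and R: "graph_property R" "\<And>X. X \<in> R \<Longrightarrow> monochromatic (\<not> c) X" "R \<noteq> {}"
    and eq: "Q \<odot> R = mono_upto c (enat r) \<odot> mono_upto (\<not> c) (enat s)" and s: "1 \<le> s"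
  shows "Q = mono_upto c (enat r)"
proof (rule eq_mono_upto_if_orders_eq[OF Q(1,2)])
  have "R \<odot> Q = mono_upto (\<not> c) (enat s) \<odot> mono_upto (\<not> \<not> c) (enat r)"
    using eq gprod_commute by simp
  then have R_le: "card (verts Y) \<le> s" if "Y \<in> R" for Y
    using factors_opposite_card_le[OF R(1) Q(1,3)] R(2) that by blast
  have Q_le: "card (verts X) \<le> r" if "X \<in> Q" for X
    using factors_opposite_card_le[OF Q(1) R(1,3) eq] Q(2) that by blast
  have "a \<in> orders Q" if a: "1 \<le> a" "a \<le> r" for a
  proof -
    let ?G = "bicoloured a s c (\<not> c) (\<not> c)"
    have "?G \<in> Q \<odot> R" unfolding eq using a s by (intro bicoloured_in_gprod) auto
    then obtain A B where AB: "A \<union> B = verts ?G" "A \<inter> B = {}"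
      "A = {} \<or> induced ?G A \<in> Q" "B = {} \<or> induced ?G B \<in> R"
      by (elim gprodE)
    have fin: "finite A" "finite B"
      using AB(1) finite_verts[OF bicoloured_in_graphs[OF a(1)]] by (metis finite_Un)+
    have mono: "adj ?G u v = c" if "u \<in> A" "v \<in> A" "u \<noteq> v" for u v
      using AB(3) Q(2) that by (metis empty_iff monochromatic_induced_iff)
    have "card A \<le> a"
    proof (cases "A \<subseteq> {..<a}")
      case True
      then show ?thesis using card_mono[of "{..<a}" A] by simp
    next
      case False
      \<comment> \<open>A vertex of the second block has only pairs of colour
        \<open>\<not> c\<close>, so it is alone in \<open>A\<close>.\<close>
      then obtain k where k: "k \<in> A" "a \<le> k" by (meson lessThan_iff not_less subsetI)
      have "u = k" if "u \<in> A" for u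
      proof (rule ccontr)
        assume "u \<noteq> k"
        moreover have "u < a + s" "k < a + s" 
          using AB(1) that k by (auto simp: bicoloured_def)
        ultimately show False using mono[OF that k(1)] k(2) by (auto simp: adj_bicoloured split: if_splits)
      qed
      then have "A = {k}" using k by blast
      then show ?thesis using a by simp
    qed
    moreover have "card B \<le> s" using AB(4) R_le[of "induced ?G B"] by auto
    moreover have "card A + card B = a + s"
    proof -
      have "card A + card B = card (verts ?G)" using AB fin card_Un_disjoint by metis
      then show ?thesis by (simp add: bicoloured_def)
    qed
    ultimately have "card A = a" by simp
    then have "induced ?G A \<in> Q" using AB(3) a by auto
    then show ?thesis unfolding orders_def using \<open>card A = a\<close> by (intro image_eqI) auto
  qed
  moreover have "1 \<le> n \<and> n \<le> r" if "n \<in> orders Q" for n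
    using that Q_le card_verts_pos property_in_graphs[OF Q(1)] unfolding orders_def by blast
  ultimately show "orders Q = orders (mono_upto c (enat r))"
    unfolding orders_mono_upto by auto
qed

text \<open>If \<open>R\<close> had only one-vertex members, \<open>Q\<close> would contain a
  subgraph of \<open>bicoloured r s c (\<not> c) c\<close> on at least \<open>r + s - 1\<close>
  vertices. Being homogeneous, it has at most \<open>r\<close> or at most \<open>s\<close> vertices,
  and both numbers are smaller.\<close>

lemma factors_opposite_large:
  assumes Q: "graph_property Q" and R: "graph_property R" "R \<noteq> {}" "Q \<noteq> {}"
    and eq: "Q \<odot> R = mono_upto c (enat r) \<odot> mono_upto (\<not> c) (enat s)" and rs: "2 \<le> r" "2 \<le> s"
  obtains Y where "Y \<in> R" "2 \<le> card (verts Y)"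
proof (rule ccontr)
  assume none: "\<not> thesis"
  note witness = that
  have small: "card (verts Y) \<le> 1" if "Y \<in> R" for Y
  proof (rule ccontr)
    assume "\<not> card (verts Y) \<le> 1"
    then have "2 \<le> card (verts Y)" by simp
    then show False using witness[OF that] none by blast
  qed
  let ?G = "bicoloured r s c (\<not> c) c"
  have "?G \<in> Q \<odot> R" unfolding eq using rs by (intro bicoloured_in_gprod) auto
  then obtain A B where AB: "?G \<in> graphs" "A \<union> B = verts ?G" "A \<inter> B = {}"
    "A = {} \<or> induced ?G A \<in> Q" "B = {} \<or> induced ?G B \<in> R"
    by (elim gprodE)
  have "finite A" "finite B" using AB(1,2) finite_verts by (metis finite_Un)+
  then have "card A + card B = card (verts ?G)" using AB card_Un_disjoint by metis
  then have "card A + card B = r + s" by (simp add: bicoloured_def)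
  moreover have "card B \<le> 1" using AB(5) small[of "induced ?G B"] by auto
  ultimately have A: "r + s \<le> card A + 1" by simp
  then have AQ: "induced ?G A \<in> Q" using AB(4) rs by auto
  then obtain d where d: "monochromatic d (induced ?G A)"
    using factors_opposite_homogeneous[OF Q R(1,2) eq] by blast
  have eq': "Q \<odot> R = mono_upto (\<not> c) (enat s) \<odot> mono_upto (\<not> \<not> c) (enat r)"
    using eq gprod_commute by simp
  have "card A \<le> r \<or> card A \<le> s"
    using factors_opposite_card_le[OF Q R(1,2) eq AQ] factors_opposite_card_le[OF Q R(1,2) eq' AQ] d
    by (cases "d = c") auto
  then show False using A rs by auto
qed

text \<open>Each factor has a member with at least two vertices, whose colour is barred from all
  such members of the other factor. This fixes one colour per factor, since one-vertex graphs fit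
  either.\<close>

lemma factors_opposite:
  assumes Q: "graph_property Q" "Q \<noteq> {}" and R: "graph_property R" "R \<noteq> {}"
    and eq: "Q \<odot> R = mono_upto c (enat r) \<odot> mono_upto (\<not> c) (enat s)" and rs: "2 \<le> r" "2 \<le> s"
  shows "Q = mono_upto c (enat r) \<and> R = mono_upto (\<not> c) (enat s) \<or>
    Q = mono_upto (\<not> c) (enat s) \<and> R = mono_upto c (enat r)"
proof -
  have eq1: "R \<odot> Q = mono_upto c (enat r) \<odot> mono_upto (\<not> c) (enat s)"
    using eq gprod_commute by simp
  have eq2: "R \<odot> Q = mono_upto (\<not> c) (enat s) \<odot> mono_upto (\<not> \<not> c) (enat r)"
    and eq3: "Q \<odot> R = mono_upto (\<not> c) (enat s) \<odot> mono_upto (\<not> \<not> c) (enat r)"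
    using eq gprod_commute by simp_all
  obtain X where X: "X \<in> Q" "2 \<le> card (verts X)"
    using factors_opposite_large[OF R(1) Q R(2) eq1 rs] by metis
  obtain Y where Y: "Y \<in> R" "2 \<le> card (verts Y)"
    using factors_opposite_large[OF Q(1) R Q(2) eq rs] by metis
  obtain d e where d: "monochromatic d X" and e: "monochromatic e Y"
    using factors_opposite_homogeneous[OF Q(1) R eq X(1)]
      factors_opposite_homogeneous[OF R(1) Q eq1 Y(1)] by blast
  have tiny: "monochromatic b G" if "G \<in> graphs" "\<not> 2 \<le> card (verts G)" for b G
    using that finite_verts card_le_Suc0_iff_eq[of "verts G"] by (auto simp: monochromatic_def)
  have de: "e = (\<not> d)"
    using factors_opposite_different_colours[OF Q(1) R(1) eq X d Y e] by blast
  have mQ: "monochromatic d Z" if "Z \<in> Q" for Z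
  proof (cases "2 \<le> card (verts Z)")
    case True
    obtain a where a: "monochromatic a Z"
      using factors_opposite_homogeneous[OF Q(1) R eq \<open>Z \<in> Q\<close>] by blast
    then have "a \<noteq> e"
      using factors_opposite_different_colours[OF Q(1) R(1) eq that True a Y e] by blast
    then show ?thesis using a de by simp
  qed (use tiny that Q property_in_graphs in blast)
  have mR: "monochromatic (\<not> d) Z" if "Z \<in> R" for Z
  proof (cases "2 \<le> card (verts Z)")
    case True
    obtain a where a: "monochromatic a Z"
      using factors_opposite_homogeneous[OF R(1) Q eq1 \<open>Z \<in> R\<close>] by blast
    then have "d \<noteq> a"
      using factors_opposite_different_colours[OF Q(1) R(1) eq X d that True a] by blast
    then show ?thesis using a by (cases a) auto
  qed (use tiny that R property_in_graphs in blast)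
  show ?thesis
  proof (cases "d = c")
    case True
    then have "Q = mono_upto c (enat r)" "R = mono_upto (\<not> c) (enat s)"
      using factors_opposite_oriented[OF Q(1) mQ Q(2) R(1) mR R(2)]
        factors_opposite_oriented[of R "\<not> c" Q s r] mQ mR Q R eq eq2 rs by auto
    then show ?thesis by blast
  next
    case False
    then have "d = (\<not> c)" by simp
    then have "Q = mono_upto (\<not> c) (enat s)" "R = mono_upto c (enat r)"
      using factors_opposite_oriented[of Q "\<not> c" R s r] factors_opposite_oriented[of R c Q r s]
        mQ mR Q R eq3 eq1 rs by auto
    then show ?thesis by blast
  qed
qed

text \<open>Control over two factors suffices: the tail of a factorisation has to be a
  \<open>mono_upto\<close> again, which is no product of nonempty properties, so the tail is a
  single factor.\<close>

lemma unique_factorisationI: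
  assumes rs: "1 \<le> r" "1 \<le> s" and P: "P = mono_upto c r \<odot> mono_upto d s"
    and factors: "\<And>Q R. graph_property Q \<Longrightarrow> Q \<noteq> {} \<Longrightarrow> graph_property R \<Longrightarrow> R \<noteq> {} \<Longrightarrow> Q \<odot> R = P \<Longrightarrow>
      Q = mono_upto c r \<and> R = mono_upto d s \<or> Q = mono_upto d s \<and> R = mono_upto c r"
  shows "unique_factorisation P"
proof -
  let ?M = "mono_upto c r" and ?N = "mono_upto d s"
  have gp: "graph_property ?M" "graph_property ?N" by (rule graph_property_mono_upto)+
  have ne: "?M \<noteq> {}" "?N \<noteq> {}" using rs by (simp_all add: mono_upto_nonempty)
  have "?M \<noteq> P" "?N \<noteq> P" using P gprod_neq_mono_upto[OF gp ne] by metis+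
  then have red: "\<not> irreducible_property P"
    using gp P unfolding irreducible_property_def reducible_property_def by blast
  have "factorisation ([?M] @ [?N]) P"
    unfolding P by (intro factorisation_append factorisation_singleton irreducible_mono_upto ne)
  moreover have "mset Qs = mset ([?M] @ [?N])" if Qs: "factorisation Qs P" for Qs
    using Qs
  proof (cases rule: factorisation_cases)
    case (2 Q Rs)
    have QR: "Q = ?M \<and> gprods Rs = ?N \<or> Q = ?N \<and> gprods Rs = ?M"
      using factors 2 by metis
    obtain R Rs' where Rs: "Rs = R # Rs'" using 2(3) by (cases Rs) auto
    have gR: "graph_property S" if "S \<in> set Rs" for S
      using factorisation_property[OF Qs] that 2(1) by simp
    have "Rs' = []"
    proof (rule ccontr)
      assume "Rs' \<noteq> []"
      have "{} \<notin> set Qs" using Qs 2(1,3) by (auto simp: factorisation_def)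
      then have "gprods Rs' \<noteq> {}" "R \<noteq> {}" "graph_property (gprods Rs')" "graph_property R"
        using gprods_nonempty[of Rs'] graph_property_gprods[of Rs'] gR 2(1) Rs \<open>Rs' \<noteq> []\<close> by auto
      then show False using QR gprod_neq_mono_upto Rs by (metis gprods_Cons)
    qed
    then have "gprods Rs = R" using Rs gR gprods_singleton by simp
    then show ?thesis using QR 2(1) Rs \<open>Rs' = []\<close> by auto
  qed (use red in simp)
  ultimately show ?thesis unfolding unique_factorisation_def by metis
qed

lemma unique_factorisation_same_colour:
  assumes "1 \<le> r" "1 \<le> s"
  shows "unique_factorisation (mono_upto c r \<odot> mono_upto c s)"
  using assms by (rule unique_factorisationI[OF _ _ refl]) (rule factors_same_colour, use assms in auto)

text \<open>A factor of bound 1 is recoloured, which reduces to equal colours; bounds of at least 2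
  make the two colours distinguishable.\<close>

lemma unique_factorisation_opposite:
  assumes "1 \<le> r" "1 \<le> s"
  shows "unique_factorisation (mono_upto c (enat r) \<odot> mono_upto (\<not> c) (enat s))"
proof -
  consider "r = 1" | "s = 1" | "2 \<le> r" "2 \<le> s" using assms by linarith
  then show ?thesis
  proof cases
    case 1
    then show ?thesis
      using unique_factorisation_same_colour[of 1 "enat s" "\<not> c"] assms mono_upto_1[of c "\<not> c"]
      by (simp add: one_enat_def)
  next
    case 2
    then show ?thesis
      using unique_factorisation_same_colour[of "enat r" 1 c] assms mono_upto_1[of c "\<not> c"]
      by (simp add: one_enat_def)
  next
    case 3
    then show ?thesis
      using assms by (intro unique_factorisationI[OF _ _ refl] factors_opposite) (auto simp: one_enat_def)
  qed
qed

section \<open>Translation between colours and edgeless or complete graphs\<close>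

theorem theorem3p1:
  fixes P :: "graph set"
  assumes "graph_property P" and "induced_hereditary P"
  shows "unique_factorisation P \<longleftrightarrow>
      irreducible_property P
    \<or> (\<exists>r s :: enat. 1 \<le> r \<and> 1 \<le> s \<and> P = edgeless_upto r \<odot> edgeless_upto s)
    \<or> (\<exists>r s :: enat. 1 \<le> r \<and> 1 \<le> s \<and> P = complete_upto r \<odot> complete_upto s)
    \<or> (\<exists>r s :: nat. 1 \<le> r \<and> 1 \<le> s \<and> P = edgeless_upto (enat r) \<odot> complete_upto (enat s))"
    (is "?U \<longleftrightarrow> ?I \<or> ?E \<or> ?K \<or> ?S")
proof
  assume ?U
  show "?I \<or> ?E \<or> ?K \<or> ?S"
  proof (cases ?I)
    case False
    obtain c d r s where rs: "1 \<le> r" "1 \<le> s" and P: "P = mono_upto c r \<odot> mono_upto d s"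
      and cd: "c = d \<or> r \<noteq> \<infinity> \<and> s \<noteq> \<infinity>"
      using unique_factorisation_imp[OF assms \<open>?U\<close> False] by metis
    show ?thesis
    proof (cases "c = d")
      case True
      then show ?thesis
        using rs P by (cases c) (auto simp: edgeless_upto_eq_mono_upto complete_upto_eq_mono_upto)
    next
      case False
      with cd obtain m n where mn: "r = enat m" "s = enat n" by auto
      then have "1 \<le> m" "1 \<le> n" using rs by (simp_all add: one_enat_def)
      \<comment> \<open>Whichever factor is edgeless, commutativity moves it to the front.\<close>
      have "P = mono_upto False (enat m) \<odot> mono_upto True (enat n) \<or>
          P = mono_upto False (enat n) \<odot> mono_upto True (enat m)"
        using False mn P gprod_commute by (cases c; cases d) auto
      then have ?S
        unfolding edgeless_upto_eq_mono_upto complete_upto_eq_mono_upto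
        using \<open>1 \<le> m\<close> \<open>1 \<le> n\<close> by blast
      then show ?thesis by blast
    qed
  qed simp
next
  assume "?I \<or> ?E \<or> ?K \<or> ?S"
  then show ?U
    unfolding edgeless_upto_eq_mono_upto complete_upto_eq_mono_upto
    using irreducible_imp_unique_factorisation[OF assms] unique_factorisation_same_colour
      unique_factorisation_opposite[of _ _ False] by auto
qed

end
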